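(* Let $W\ge 0$ be a measurable function on $\mathbb{R}^2$ that is bounded in a neighborhood of at least one point, and let $\Psi$ be an $N$-function such that $$\lim_{s\to\infty}\frac{\Psi(s)}{\mathcal{B}(s)} = 0 .$$ Then there exists a compactly supported $V\ge 0$ on $\mathbb{R}^2$ such that $$\int_{\mathbb{R}^2}V(x)W(x)\,dx + \|V\|_{\Psi,\mathbb{R}^2}<\infty$$ and $N_-(\mathcal{E}_V)=\infty$.
   Context: For a Hermitian form $\mathbf{q}$ with domain $\mathrm{Dom}(\mathbf{q})$ in a Hilbert space, $N_-(\mathbf{q}) := \sup\{\dim\mathcal{L} : \mathcal{L}\subseteq \mathrm{Dom}(\mathbf{q}) \text{ a linear subspace},\ \mathbf{q}[u]<0\ \forall u\in\mathcal{L}\setminus\{0\}\}\in\{0,1,2,\dots\}\cup\{\infty\}$. For locally integrable $V\ge 0$ on $\mathbb{R}^2$ (potentials $V$ are always assumed locally integrable), $\mathcal{E}_V[w] := \int_{\mathbb{R}^2}|\nabla w(x)|^2dx - \int_{\mathbb{R}^2}V(x)|w(x)|^2dx$ with $\mathrm{Dom}(\mathcal{E}_V) := W^1_2(\mathbb{R}^2)\cap L_2(\mathbb{R}^2,V(x)dx)$, where $W^1_2$ is the Sobolev space of $L_2$ functions with $L_2$ first-order weak derivatives. $\mathcal{B}(s)=(1+|s|)\ln(1+|s|)-|s|$, $s\in\mathbb{R}$. An $N$-function is an even, continuous, convex function $\Psi:\mathbb{R}\to[0,\infty)$ with $\Psi(s)>0$ for $s\neq0$, $\Psi(s)/s\to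 0$ as $s\to0+$ and $\Psi(s)/s\to\infty$ as $s\to\infty$; its complementary $N$-function is $\Phi(t)=\sup_{s\ge0}(s|t|-\Psi(s))$. The Orlicz norm is $\|f\|_{\Psi,\mathbb{R}^2} := \sup\{|\int_{\mathbb{R}^2}fg\,dx| : g \text{ measurable},\ \int_{\mathbb{R}^2}\Phi(g)\,dx\le1\}$ ($+\infty$ if $f$ is not in the Orlicz space $L_\Psi(\mathbb{R}^2)$). *)

theory Defs
  imports "HOL-Analysis.Analysis" "HOL-Library.Function_Algebras" "HOL-Library.Extended_Nat"
begin

section \<open>Complex-valued functions as a complex vector space\<close>

definition fscale :: "complex \<Rightarrow> ('a \<Rightarrow> complex) \<Rightarrow> 'a \<Rightarrow> complex"
  where "fscale c f = (\<lambda>x. c * f x)"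

interpretation cfun: vector_space fscale
  by unfold_locales (auto simp: fscale_def fun_eq_iff algebra_simps)

text \<open>The library's dimension is a natural number, with junk values for spaces that are not
  finite-dimensional, hence the case distinction.\<close>

definition cfun_edim :: "('a \<Rightarrow> complex) set \<Rightarrow> enat"
  where "cfun_edim L =
    (if \<exists>B. finite B \<and> cfun.span B = L then enat (cfun.dim L) else \<infinity>)"

text \<open>
  The number \<open>N\<^sub>-(q)\<close> for a quadratic form \<open>q\<close> with domain \<open>D\<close>.

  Below, \<open>D\<close> consists of functions rather than of classes of functions modulo equality almost
  everywhere. This does not change the value. A form that depends only on the class vanishes on
  null functions (see \<open>form_E_not_neg_null\<close>), so the condition \<open>q u < 0\<close> for \<open>u \<noteq> 0\<close>
  forces \<open>L\<close> to contain no null function but \<open>0\<close>, and \<open>L\<close> is isomorphic to its space of classes.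
  Conversely a linear space of classes lifts to a linear space of representatives, via a basis.
\<close>

definition neg_index :: "('a \<Rightarrow> complex) set \<Rightarrow> (('a \<Rightarrow> complex) \<Rightarrow> real) \<Rightarrow> enat"
  where "neg_index D q =
    (SUP L \<in> {L. cfun.subspace L \<and> L \<subseteq> D \<and> (\<forall>u \<in> L - {0}. q u < 0)}. cfun_edim L)"

section \<open>Weak derivatives and Sobolev space\<close>

definition locally_integrable :: "('a::euclidean_space \<Rightarrow> 'b::euclidean_space) \<Rightarrow> bool"
  where "locally_integrable f \<longleftrightarrow> (\<forall>K. compact K \<longrightarrow> f absolutely_integrable_on K)"

definition pderivative :: "'n \<Rightarrow> (real^'n \<Rightarrow> real) \<Rightarrow> real^'n \<Rightarrow> real"
  where "pderivative i f = (\<lambda>x. frechet_derivative f (at x) (axis i 1))"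

primrec C_k :: "nat \<Rightarrow> (real^'n \<Rightarrow> real) \<Rightarrow> bool" where
  "C_k 0 f \<longleftrightarrow> continuous_on UNIV f"
| "C_k (Suc k) f \<longleftrightarrow> f differentiable_on UNIV \<and> (\<forall>i. C_k k (pderivative i f))"

definition test_function :: "(real^'n \<Rightarrow> real) \<Rightarrow> bool"
  where "test_function \<phi> \<longleftrightarrow> (\<forall>k. C_k k \<phi>) \<and> compact (closure {x. \<phi> x \<noteq> 0})"

definition has_weak_pderiv :: "'n \<Rightarrow> (real^'n \<Rightarrow> complex) \<Rightarrow> (real^'n \<Rightarrow> complex) \<Rightarrow> bool"
  where "has_weak_pderiv i w g \<longleftrightarrow>
    locally_integrable w \<and> locally_integrable g \<and>
    (\<forall>\<phi>. test_function \<phi> \<longrightarrow>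
      (LINT x|lebesgue. w x * complex_of_real (pderivative i \<phi> x)) =
      - (LINT x|lebesgue. g x * complex_of_real (\<phi> x)))"

text \<open>A weak derivative is unique up to a null set; the choice of version is irrelevant.\<close>

definition weak_pderiv :: "'n \<Rightarrow> (real^'n \<Rightarrow> complex) \<Rightarrow> real^'n \<Rightarrow> complex"
  where "weak_pderiv i w = (SOME g. has_weak_pderiv i w g)"

definition L2 :: "('a::euclidean_space \<Rightarrow> complex) set"
  where "L2 = {f \<in> borel_measurable lebesgue. integrable lebesgue (\<lambda>x. (cmod (f x))\<^sup>2)}"

definition W12 :: "(real^'n \<Rightarrow> complex) set"
  where "W12 = {w \<in> L2. \<forall>i. \<exists>g \<in> L2. has_weak_pderiv i w g}"

section \<open>The form of the Schroedinger operator with potential \<open>-V\<close>\<close>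

definition L2_weighted :: "('a::euclidean_space \<Rightarrow> real) \<Rightarrow> ('a \<Rightarrow> complex) set"
  where "L2_weighted V =
    {f \<in> borel_measurable lebesgue. integrable lebesgue (\<lambda>x. V x * (cmod (f x))\<^sup>2)}"

definition dom_E :: "(real^2 \<Rightarrow> real) \<Rightarrow> (real^2 \<Rightarrow> complex) set"
  where "dom_E V = W12 \<inter> L2_weighted V"

definition form_E :: "(real^2 \<Rightarrow> real) \<Rightarrow> (real^2 \<Rightarrow> complex) \<Rightarrow> real"
  where "form_E V w =
    (LINT x|lebesgue. (\<Sum>i\<in>UNIV. (cmod (weak_pderiv i w x))\<^sup>2)) -
    (LINT x|lebesgue. V x * (cmod (w x))\<^sup>2)"

lemma form_E_not_neg_null:
  assumes "AE x in lebesgue. w x = 0"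
  shows "\<not> form_E V w < 0"
proof -
  have "(LINT x|lebesgue. V x * (cmod (w x))\<^sup>2) = 0"
    by (rule integral_eq_zero_AE) (use assms in eventually_elim, simp)
  moreover have "(LINT x|lebesgue. (\<Sum>i\<in>UNIV. (cmod (weak_pderiv i w x))\<^sup>2)) \<ge> 0"
    by (intro integral_nonneg_AE AE_I2 sum_nonneg) simp
  ultimately show ?thesis
    by (simp add: form_E_def)
qed

section \<open>N-functions and the Orlicz norm\<close>

definition B_fun :: "real \<Rightarrow> real"
  where "B_fun s = (1 + \<bar>s\<bar>) * ln (1 + \<bar>s\<bar>) - \<bar>s\<bar>"

definition N_function :: "(real \<Rightarrow> real) \<Rightarrow> bool"
  where "N_function \<Psi> \<longleftrightarrow>
    (\<forall>s. 0 \<le> \<Psi> s) \<and> (\<forall>s. \<Psi> (- s) = \<Psi> s) \<and> continuous_on UNIV \<Psi> \<and> convex_on UNIV \<Psi> \<and>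
    (\<forall>s. s \<noteq> 0 \<longrightarrow> 0 < \<Psi> s) \<and>
    ((\<lambda>s. \<Psi> s / s) \<longlongrightarrow> 0) (at_right 0) \<and>
    filterlim (\<lambda>s. \<Psi> s / s) at_top at_top"

text \<open>The supremum is taken over a set of reals that is bounded above if \<open>\<Psi>\<close> is an N-function.\<close>

definition complementary :: "(real \<Rightarrow> real) \<Rightarrow> real \<Rightarrow> real"
  where "complementary \<Psi> t = (SUP s\<in>{0..}. s * \<bar>t\<bar> - \<Psi> s)"

text \<open>The linear hull of the Orlicz class \<open>{f. \<integral> \<Psi>(f) < \<infinity>}\<close>.\<close>

definition orlicz_space :: "(real \<Rightarrow> real) \<Rightarrow> ('a::euclidean_space \<Rightarrow> real) set"
  where "orlicz_space \<Psi> = {f \<in> borel_measurable lebesgue.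
    \<exists>\<kappa>>0. (\<integral>\<^sup>+x. ennreal (\<Psi> (f x / \<kappa>)) \<partial>lebesgue) < \<infinity>}"

text \<open>For \<open>f\<close> in the Orlicz space all products \<open>f x * g x\<close> below are integrable, by Young's
  inequality, so no integral takes its default value.\<close>

definition orlicz_norm :: "(real \<Rightarrow> real) \<Rightarrow> ('a::euclidean_space \<Rightarrow> real) \<Rightarrow> ennreal"
  where "orlicz_norm \<Psi> f =
    (if f \<in> orlicz_space \<Psi> then
       (SUP g \<in> {g \<in> borel_measurable lebesgue.
                   (\<integral>\<^sup>+x. ennreal (complementary \<Psi> (g x)) \<partial>lebesgue) \<le> 1}.
          ennreal \<bar>LINT x|lebesgue. f x * g x\<bar>)
     else \<infinity>)"

end

theory Submission
  imports Defs "HOL-Computational_Algebra.Polynomial" "HOL-Real_Asymp.Real_Asymp"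
begin

text \<open>
  In the plane, the logarithmic cutoff that equals \<open>ln (R / r)\<close> on the disc of radius \<open>r\<close>, vanishes
  outside the disc of radius \<open>R\<close> and is \<open>ln (R / \<rho>)\<close> at distance \<open>\<rho>\<close> in between has energy of order \<open>ln (R / r)\<close>.
  With \<open>r = R / 2 ^ n\<close>, a well of height \<open>t = 16 * 4 ^ n / (n * R\<^sup>2)\<close> on the small disc makes the form
  negative on this function, while \<open>r\<^sup>2 * B_fun t\<close> stays bounded as \<open>n\<close> grows; hence
  \<open>r\<^sup>2 * \<Psi> t\<close> tends to \<open>0\<close>. Infinitely many such wells in disjoint discs near the
  point where \<open>W\<close> is bounded, the \<open>k\<close>-th one with \<open>r\<^sup>2 * \<Psi> t\<close> and \<open>r\<^sup>2 * t\<close> at most \<open>2\<^sup>-\<^sup>k\<close>, give \<open>V\<close>; the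
  cutoffs have disjoint supports, so the form is negative on their whole linear span.
\<close>

section \<open>Uniqueness of weak derivatives\<close>

text \<open>The profile reflects the vanishing capacity of points in the plane: the energy of the
  cutoff grows only like \<open>n\<close>, the square of its height like \<open>n\<close> squared.
  The well contributes \<open>pi * t * r^2 * (n * ln 2)^2\<close>. Normalising
  \<open>t * r^2 * n\<close> to 16 turns this into \<open>16 * pi * n * (ln 2)^2\<close>, against
  the energy bound \<open>4 * pi * n\<close>; negativity then amounts to
  \<open>ln 2 > 1 / 2\<close>, and this is where 16 comes from. Under the normalisation
  \<open>ln t\<close> grows like \<open>n * ln 4\<close>, which exactly cancels the decay
  \<open>16 / n\<close> of \<open>t * r^2\<close>. So \<open>r^2 * B_fun t\<close> is bounded but
  does not tend to 0, and it is the quotient \<open>\<Psi> t / B_fun t\<close> that supplies the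
  smallness. The formal obstacle is that \<open>form_E\<close> is built on
  \<open>weak_pderiv\<close>, an arbitrary choice among all weak derivatives. Evaluating the form
  therefore takes two facts: weak derivatives are unique up to null sets, and the cutoffs, which are
  Lipschitz but not smooth, have the expected explicit ones.\<close>

lemma sigma_finite_measure_lebesgue: "sigma_finite_measure (lebesgue :: 'a::euclidean_space measure)"
proof
  let ?A = "range (\<lambda>n::nat. box (- (real n *\<^sub>R One)) (real n *\<^sub>R One) :: 'a set)"
  have "\<Union> ?A = UNIV" by (rule UN_box_eq_UNIV)
  then show "\<exists>A. countable A \<and> A \<subseteq> sets lebesgue \<and> \<Union> A = space lebesgue \<and>
      (\<forall>a\<in>A. emeasure (lebesgue :: 'a measure) a \<noteq> \<infinity>)"
    by (intro exI[of _ ?A]) (use fmeasurableD2[OF lmeasurable_box] in auto)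
qed

text \<open>Boxes form an intersection-stable generator of the Borel sets, so vanishing integrals
  pass from boxes to Borel sets through complements and disjoint unions, and from there to Lebesgue
  sets. A function whose integral over every measurable set is 0 vanishes almost everywhere.
  Countably many boxes exhaust the space.\<close>

lemma AE_eq_0_if_box_integrals_0:
  fixes h :: "'a::euclidean_space \<Rightarrow> 'b::euclidean_space"
  assumes h: "locally_integrable h"
    and box0: "\<And>a b. (LINT x:box a b|lebesgue. h x) = 0"
  shows "AE x in lebesgue. h x = 0"
proof -
  have *: "AE x in lebesgue. x \<in> box (- real n *\<^sub>R One) (real n *\<^sub>R One) \<longrightarrow> h x = 0" for n
  proof -
    define B :: "'a set" where "B = box (- real n *\<^sub>R One) (real n *\<^sub>R One)"
    \<comment> \<open>Cutting off outside a large box makes the function globally integrable, as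
      complements and countable unions require. The box hypothesis survives because two boxes meet
      in a box.\<close>
    define f where "f x = indicator B x *\<^sub>R h x" for x
    have B[measurable]: "B \<in> sets lebesgue" by (simp add: B_def)
    have "set_integrable lebesgue (cbox (- real n *\<^sub>R One) (real n *\<^sub>R One)) h"
      using h compact_cbox unfolding locally_integrable_def by blast
    then have "set_integrable lebesgue B h"
      by (rule set_integrable_subset) (auto simp: B_def box_subset_cbox)
    then have f: "integrable lebesgue f"
      by (simp add: set_integrable_def f_def[abs_def])
    have fI: "set_integrable lebesgue A f" if "A \<in> sets lebesgue" for A
      using integrable_mult_indicator[OF that f] by (simp add: set_integrable_def)
    have f_box: "(LINT x:box a b|lebesgue. f x) = 0" for a b :: 'a
    proof -
      obtain c d where cd: "box a b \<inter> B = box c d"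
        unfolding B_def box_Int_box by blast
      have "(LINT x:box a b|lebesgue. f x) = (LINT x:box a b \<inter> B|lebesgue. h x)"
        unfolding set_lebesgue_integral_def f_def
        by (intro Bochner_Integration.integral_cong) (auto simp: indicator_def)
      then show ?thesis using cd box0 by simp
    qed
    have borel0: "(LINT x:A|lebesgue. f x) = 0" if "A \<in> sets borel" for A
    proof -
      have "Int_stable (range (\<lambda>(a, b). box a b :: 'a set))"
        by (auto simp: Int_stable_def box_Int_box)
      moreover have "range (\<lambda>(a, b). box a b :: 'a set) \<subseteq> Pow UNIV" by simp
      moreover have sb: "sigma_sets UNIV (range (\<lambda>(a, b). box a b :: 'a set)) = sets borel"
        by (simp add: borel_eq_box)
      then have "A \<in> sigma_sets UNIV (range (\<lambda>(a, b). box a b))"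
        using that by simp
      ultimately show ?thesis
      proof (induction rule: sigma_sets_induct_disjoint)
        case (basic A)
        then show ?case using f_box by auto
      next
        case empty
        show ?case by (simp add: set_lebesgue_integral_def)
      next
        case (compl A)
        then have A: "A \<in> sets lebesgue" using sb by auto
        have "(LINT x:UNIV - A|lebesgue. f x) = (LINT x:UNIV|lebesgue. f x) - (LINT x:A|lebesgue. f x)"
        proof -
          have "indicat_real (UNIV - A) x *\<^sub>R f x = indicat_real UNIV x *\<^sub>R f x - indicat_real A x *\<^sub>R f x" for x
            by (simp add: indicator_def)
          moreover have "UNIV \<in> sets (lebesgue :: 'a measure)" by simp
          ultimately show ?thesis
            using fI[OF A] fI[of UNIV] unfolding set_lebesgue_integral_def set_integrable_def
            by (simp only: Bochner_Integration.integral_diff)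
        qed
        \<comment> \<open>The total integral is again a box integral of \<open>h\<close>, because
          \<open>f\<close> lives on \<open>B\<close>; this settles complements.\<close>
        moreover have "(LINT x:UNIV|lebesgue. f x) = (LINT x:B|lebesgue. h x)"
          by (simp add: set_lebesgue_integral_def f_def)
        ultimately show ?case using compl box0 by (simp add: B_def)
      next
        case (union A)
        have A: "A i \<in> sets lebesgue" for i
          using union(2) sb by auto
        show ?case
          using union A by (subst lebesgue_integral_countable_add) (auto simp: disjoint_family_on_def intro!: fI)
      qed
    qed
    have "AE x in lebesgue. f x = 0"
    proof (rule sigma_finite_measure.density_zero[OF sigma_finite_measure_lebesgue f])
      fix A :: "'a set" assume "A \<in> sets lebesgue"
      \<comment> \<open>A Lebesgue set is a Borel set up to a subset of a Borel null set, which does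
        not affect the integral.\<close>
      then obtain S N N' where A: "A = S \<union> N" "N \<subseteq> N'" "N' \<in> null_sets lborel" "S \<in> sets lborel"
        by (rule sets_completionE)
      have "AE x in lebesgue. x \<notin> N'"
        using A by (intro AE_completion AE_not_in)
      then have "AE x in lebesgue. indicat_real A x *\<^sub>R f x = indicat_real S x *\<^sub>R f x"
        by eventually_elim (use A(1,2) in \<open>auto simp: indicator_def\<close>)
      moreover have S: "S \<in> sets lebesgue" using A(4) by (rule sets_completionI_sets)
      ultimately have "(LINT x:A|lebesgue. f x) = (LINT x:S|lebesgue. f x)"
        unfolding set_lebesgue_integral_def
        using fI[OF \<open>A \<in> sets lebesgue\<close>] fI[OF S]
        by (intro integral_cong_AE) (simp_all only: set_integrable_def borel_measurable_integrable)
      then show "(LINT x:A|lebesgue. f x) = 0" using borel0 A by simp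
    qed
    then show ?thesis
      by eventually_elim (auto simp: f_def B_def indicator_def split: if_splits)
  qed
  have "AE x in lebesgue. \<forall>n::nat. x \<in> box (- real n *\<^sub>R One) (real n *\<^sub>R One) \<longrightarrow> h x = 0"
    unfolding AE_all_countable by (intro allI *)
  then show ?thesis
  proof eventually_elim
    case (elim x)
    have "x \<in> (\<Union>n::nat. box (- (real n *\<^sub>R One)) (real n *\<^sub>R One))"
      by (simp only: UN_box_eq_UNIV UNIV_I)
    then obtain n :: nat where "x \<in> box (- (real n *\<^sub>R One)) (real n *\<^sub>R One)"
      by (rule UN_E)
    then show ?case using elim unfolding scaleR_minus_left by blast
  qed
qed

section \<open>Calculus of \<open>C_k\<close> functions\<close>

lemma C_k_Suc_imp_C_k: "C_k (Suc k) f \<Longrightarrow> C_k k f"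
  by (induction k arbitrary: f) (auto intro: differentiable_imp_continuous_on)

lemma pderivative_eq:
  "(f has_derivative f') (at x) \<Longrightarrow> pderivative i f x = f' (axis i 1)"
  by (simp add: pderivative_def frechet_derivative_at[symmetric])

lemma pderivative_add:
  assumes "f differentiable at x" "g differentiable at x"
  shows "pderivative i (\<lambda>x. f x + g x) x = pderivative i f x + pderivative i g x"
proof -
  have "((\<lambda>x. f x + g x) has_derivative
      (\<lambda>v. frechet_derivative f (at x) v + frechet_derivative g (at x) v)) (at x)"
    using assms by (intro has_derivative_add) (simp_all add: frechet_derivative_works[symmetric])
  then show ?thesis by (simp add: pderivative_eq) (simp add: pderivative_def)
qed

lemma pderivative_mult:
  fixes f g :: "real^'n \<Rightarrow> real"
  assumes "f differentiable at x" "g differentiable at x"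
  shows "pderivative i (\<lambda>x. f x * g x) x = f x * pderivative i g x + pderivative i f x * g x"
proof -
  have "((\<lambda>x. f x * g x) has_derivative
      (\<lambda>v. f x * frechet_derivative g (at x) v + frechet_derivative f (at x) v * g x)) (at x)"
    using assms by (intro has_derivative_mult) (simp_all add: frechet_derivative_works[symmetric])
  then show ?thesis by (simp add: pderivative_eq) (simp add: pderivative_def)
qed

lemma C_k_add: "C_k k f \<Longrightarrow> C_k k g \<Longrightarrow> C_k k (\<lambda>x. f x + g x)"
proof (induction k arbitrary: f g)
  case 0
  then show ?case by (auto intro: continuous_on_add)
next
  case (Suc k)
  then have "f differentiable at x" "g differentiable at x" for x
    by (auto simp: differentiable_on_eq_differentiable_at)
  then have "pderivative i (\<lambda>x. f x + g x) = (\<lambda>x. pderivative i f x + pderivative i g x)" for i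
    by (auto simp: pderivative_add)
  then show ?case using Suc by (auto intro: differentiable_on_add)
qed

lemma C_k_mult: "C_k k f \<Longrightarrow> C_k k g \<Longrightarrow> C_k k (\<lambda>x. f x * g x)"
proof (induction k arbitrary: f g)
  case 0
  then show ?case by (auto intro: continuous_on_mult)
next
  case (Suc k)
  then have "f differentiable at x" "g differentiable at x" for x
    by (auto simp: differentiable_on_eq_differentiable_at)
  then have "pderivative i (\<lambda>x. f x * g x) = (\<lambda>x. f x * pderivative i g x + pderivative i f x * g x)" for i
    by (auto simp: pderivative_mult)
  moreover have "C_k k f" "C_k k g"
    using Suc.prems by (blast intro: C_k_Suc_imp_C_k)+
  ultimately show ?case using Suc by (auto intro!: differentiable_on_mult C_k_add)
qed

lemma C_k_const: "C_k k (\<lambda>x::real^'n. c)"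
proof (induction k arbitrary: c)
  case (Suc k)
  have "pderivative i (\<lambda>x::real^'n. c) = (\<lambda>x. 0)" for i :: 'n
    by (auto simp: pderivative_def)
  then show ?case using Suc by simp
qed auto

lemma C_k_prod: "finite A \<Longrightarrow> (\<And>i. i \<in> A \<Longrightarrow> C_k k (f i)) \<Longrightarrow> C_k k (\<lambda>x. \<Prod>i\<in>A. f i x)"
  by (induction A rule: finite_induct) (auto intro: C_k_const C_k_mult)

section \<open>Flat functions and smooth bumps on boxes\<close>

definition flat_exp :: "real poly \<Rightarrow> real \<Rightarrow> real"
  where "flat_exp p t = (if t > 0 then poly p (1 / t) * exp (- (1 / t)) else 0)"

lemma tendsto_poly_mult_exp_neg: "((\<lambda>s. poly p s * exp (- s)) \<longlongrightarrow> (0::real)) at_top"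
proof -
  have "((\<lambda>s. \<Sum>i\<le>degree p. coeff p i * (s ^ i / exp s)) \<longlongrightarrow> (\<Sum>i\<le>degree p. coeff p i * 0)) at_top"
    by (intro tendsto_intros tendsto_power_div_exp_0)
  moreover have "(\<Sum>i\<le>degree p. coeff p i * (s ^ i / exp s)) = poly p s * exp (- s)" for s
    by (simp add: poly_altdef sum_distrib_right exp_minus divide_inverse mult.assoc)
  ultimately show ?thesis by simp
qed

text \<open>With \<open>s = 1 / t\<close> the derivative in \<open>t\<close> is \<open>- s^2\<close>
  times the derivative in \<open>s\<close>, which turns \<open>p(s) * exp (- s)\<close> into
  \<open>s^2 * (p - p')(s) * exp (- s)\<close>. The family is thus closed under differentiation, and
  smoothness of all its members follows by an induction that lets \<open>p\<close> vary.\<close>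

lemma flat_exp_has_derivative:
  "(flat_exp p has_real_derivative flat_exp (monom 1 2 * (p - pderiv p)) t) (at t)"
proof (cases t "0::real" rule: linorder_cases)
  case less
  have "((\<lambda>_. 0) has_real_derivative 0) (at t)" by simp
  then have "(flat_exp p has_real_derivative 0) (at t)"
    by (rule has_field_derivative_transform_within_open[of _ _ _ "{..<0}"])
      (use less in \<open>auto simp: flat_exp_def\<close>)
  then show ?thesis using less by (simp add: flat_exp_def)
next
  case greater
  have "((\<lambda>t. poly p (1 / t) * exp (- (1 / t))) has_real_derivative
      poly p (1 / t) * (exp (- (1 / t)) * (1 / t\<^sup>2)) + poly (pderiv p) (1 / t) * (- (1 / t\<^sup>2)) * exp (- (1 / t))) (at t)"
    using greater
    by (auto intro!: derivative_eq_intros DERIV_chain2[OF poly_DERIV] simp: power2_eq_square)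
  then have "(flat_exp p has_real_derivative
      poly p (1 / t) * (exp (- (1 / t)) * (1 / t\<^sup>2)) + poly (pderiv p) (1 / t) * (- (1 / t\<^sup>2)) * exp (- (1 / t))) (at t)"
    by (rule has_field_derivative_transform_within_open[of _ _ _ "{0<..}"])
      (use greater in \<open>auto simp: flat_exp_def\<close>)
  then show ?thesis
    using greater by (simp add: flat_exp_def poly_monom algebra_simps power_divide)
next
  case equal
  have R: "((\<lambda>h. flat_exp p h / h) \<longlongrightarrow> 0) (at_right 0)"
  proof -
    have "filterlim (\<lambda>h. 1 / h :: real) at_top (at_right 0)"
      using filterlim_inverse_at_top_right by (simp add: inverse_eq_divide)
    \<comment> \<open>\<open>pCons 0 p\<close> is the polynomial \<open>s * p(s)\<close>: the
      division by \<open>h\<close> in the difference quotient at 0 is absorbed into the polynomial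
      factor.\<close>
    then have "((\<lambda>h. poly (pCons 0 p) (1 / h) * exp (- (1 / h))) \<longlongrightarrow> 0) (at_right (0::real))"
      by (rule filterlim_compose[OF tendsto_poly_mult_exp_neg])
    moreover have "\<forall>\<^sub>F h in at_right 0. poly (pCons 0 p) (1 / h) * exp (- (1 / h)) = flat_exp p h / h"
      using eventually_at_right_less[of "0::real"] by eventually_elim (simp add: flat_exp_def)
    ultimately show ?thesis by (rule Lim_transform_eventually)
  qed
  have L: "((\<lambda>h. flat_exp p h / h) \<longlongrightarrow> 0) (at_left 0)"
    by (rule Lim_transform_eventually[OF tendsto_const])
      (auto simp: flat_exp_def eventually_at_left_field intro: exI[of _ "-1"])
  show ?thesis
    using L R equal by (simp add: has_field_derivative_iff filterlim_split_at flat_exp_def)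
qed

lemma flat_exp_affine_has_derivative:
  "((\<lambda>x::real^'n. flat_exp p (c * x $ i + d)) has_derivative
    (\<lambda>v. flat_exp (monom 1 2 * (p - pderiv p)) (c * x $ i + d) * (c * v $ i))) (at x)"
proof -
  have "((\<lambda>x::real^'n. c * x $ i + d) has_derivative (\<lambda>v. c * v $ i)) (at x)"
    by (auto intro!: derivative_eq_intros bounded_linear.has_derivative[OF bounded_linear_vec_nth])
  from has_derivative_compose[OF this flat_exp_has_derivative[unfolded has_field_derivative_def]]
  show ?thesis by simp
qed

lemma C_k_flat_exp: "C_k k (\<lambda>x::real^'n. flat_exp p (c * x $ i + d))"
proof (induction k arbitrary: p)
  case 0
  have "isCont (\<lambda>x::real^'n. flat_exp p (c * x $ i + d)) x" for x
    using flat_exp_affine_has_derivative has_derivative_continuous by blast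
  then show ?case by (simp add: continuous_on_eq_continuous_at)
next
  case (Suc k)
  have "(\<lambda>x::real^'n. flat_exp p (c * x $ i + d)) differentiable_on UNIV"
    using flat_exp_affine_has_derivative differentiableI
    by (metis differentiable_on_eq_differentiable_at open_UNIV)
  moreover have "pderivative j (\<lambda>x::real^'n. flat_exp p (c * x $ i + d)) =
      (\<lambda>x. (if j = i then c else 0) * flat_exp (monom 1 2 * (p - pderiv p)) (c * x $ i + d))" for j
    by (auto simp: pderivative_eq[OF flat_exp_affine_has_derivative] axis_def)
  ultimately show ?case
    using Suc by (auto intro!: C_k_mult C_k_const)
qed

text \<open>The function \<open>exp (- 1 / t)\<close>, extended by 0, lies between 0 and 1, and
  \<open>exp (- 1 / (m * s))\<close> tends to 1 for every fixed \<open>s > 0\<close>. A product of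
  such factors, two per coordinate, is supported in the box and fills it up as the steepness
  \<open>m\<close> grows.\<close>

lemma ex_test_functions_tendsto_indicator_box:
  fixes a b :: "real^'n"
  obtains \<phi> where "\<And>m::nat. test_function (\<phi> m)"
    and "\<And>m x. 0 \<le> \<phi> m x \<and> \<phi> m x \<le> indicator (box a b) x"
    and "\<And>x. (\<lambda>m. \<phi> m x) \<longlonglongrightarrow> indicator (box a b) x"
proof
  \<comment> \<open>The arguments are kept in the affine form of \<open>C_k_flat_exp\<close>;
    \<open>eq\<close> converts them to multiples of the distances to the faces. \<open>Suc m\<close>
    keeps the steepness positive.\<close>
  define \<phi> where "\<phi> m x = (\<Prod>i\<in>UNIV. flat_exp 1 (real (Suc m) * x $ i + (- real (Suc m) * a $ i)) *
      flat_exp 1 (- real (Suc m) * x $ i + real (Suc m) * b $ i))" for m and x :: "real^'n"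
  have eq: "real (Suc m) * x $ i + (- real (Suc m) * a $ i) = real (Suc m) * (x $ i - a $ i)"
    "- real (Suc m) * x $ i + real (Suc m) * b $ i = real (Suc m) * (b $ i - x $ i)" for m i and x :: "real^'n"
    by (auto simp: algebra_simps)
  have pos: "0 < real (Suc m) * s \<longleftrightarrow> 0 < s" for m s
    by (simp add: zero_less_mult_iff del: of_nat_Suc)
  have F01: "0 \<le> flat_exp 1 t \<and> flat_exp 1 t \<le> 1" for t by (simp add: flat_exp_def)
  have F0: "t \<le> 0 \<Longrightarrow> flat_exp 1 t = 0" for t by (simp add: flat_exp_def)
  have \<phi>0: "\<phi> m x = 0" if x: "x \<notin> box a b" for m x
  proof -
    obtain i where "x $ i \<le> a $ i \<or> b $ i \<le> x $ i"
      using x by (auto simp: mem_box_cart not_less)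
    then show ?thesis
      unfolding \<phi>_def eq by (intro prod_zero) (auto intro!: exI[of _ i] F0 simp: mult_le_0_iff)
  qed
  show "0 \<le> \<phi> m x \<and> \<phi> m x \<le> indicator (box a b) x" for m x
  proof -
    have "0 \<le> \<phi> m x" "\<phi> m x \<le> 1"
      using F01 unfolding \<phi>_def by (auto intro!: prod_nonneg prod_le_1 mult_le_one)
    then show ?thesis using \<phi>0[of x m] by (auto simp: indicator_def)
  qed
  show "test_function (\<phi> m)" for m
  proof -
    have "bounded {x. \<phi> m x \<noteq> 0}"
      by (rule bounded_subset[OF bounded_box[of a b]]) (use \<phi>0 in blast)
    then show ?thesis
      unfolding test_function_def \<phi>_def by (auto intro!: C_k_prod C_k_mult C_k_flat_exp)
  qed
  show "(\<lambda>m. \<phi> m x) \<longlonglongrightarrow> indicator (box a b) x" for x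
  proof (cases "x \<in> box a b")
    case True
    have F1: "(\<lambda>m. flat_exp 1 (real (Suc m) * s)) \<longlonglongrightarrow> 1" if "s > 0" for s
    proof -
      have "(\<lambda>m. exp (- ((1 / s) * inverse (real (Suc m))))) \<longlonglongrightarrow> exp (- ((1 / s) * 0))"
        by (intro tendsto_intros LIMSEQ_inverse_real_of_nat)
      moreover have "flat_exp 1 (real (Suc m) * s) = exp (- ((1 / s) * inverse (real (Suc m))))" for m
        using that pos by (simp add: flat_exp_def divide_simps del: of_nat_Suc)
      ultimately show ?thesis by simp
    qed
    have "(\<lambda>m. \<phi> m x) \<longlonglongrightarrow> (\<Prod>i\<in>(UNIV::'n set). 1 * 1)"
      unfolding \<phi>_def eq using True
      by (intro tendsto_prod tendsto_mult F1) (auto simp: mem_box_cart)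
    then show ?thesis using True by simp
  qed (simp add: \<phi>0)
qed

section \<open>Pairing with test functions\<close>

lemma integrable_mult_bounded:
  fixes w :: "'a \<Rightarrow> complex"
  assumes w: "integrable M w" and \<psi>: "\<psi> \<in> borel_measurable M"
    and bound: "\<And>x. \<bar>\<psi> x\<bar> \<le> B"
  shows "integrable M (\<lambda>x. w x * complex_of_real (\<psi> x))"
proof (rule Bochner_Integration.integrable_bound)
  show "integrable M (\<lambda>x. B *\<^sub>R w x)"
    using w by (rule integrable_scaleR_right)
  show "(\<lambda>x. w x * complex_of_real (\<psi> x)) \<in> borel_measurable M"
    using borel_measurable_integrable[OF w] \<psi> by measurable
  have "norm (w x * complex_of_real (\<psi> x)) \<le> norm (B *\<^sub>R w x)" for x
    using mult_right_mono[of "\<bar>\<psi> x\<bar>" "\<bar>B\<bar>" "norm (w x)"] bound[of x]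
    by (simp add: norm_mult mult.commute)
  then show "AE x in M. norm (w x * complex_of_real (\<psi> x)) \<le> norm (B *\<^sub>R w x)"
    by simp
qed

lemma integrable_locally_integrable_mult:
  fixes w :: "'a::euclidean_space \<Rightarrow> complex"
  assumes w: "locally_integrable w" and \<psi>: "\<psi> \<in> borel_measurable lebesgue"
    and bound: "\<And>x. \<bar>\<psi> x\<bar> \<le> B" and K: "compact K" "\<And>x. x \<notin> K \<Longrightarrow> \<psi> x = 0"
  shows "integrable lebesgue (\<lambda>x. w x * complex_of_real (\<psi> x))"
proof -
  have "integrable lebesgue (\<lambda>x. indicator K x *\<^sub>R w x)"
    using w K(1) unfolding locally_integrable_def set_integrable_def by blast
  from integrable_mult_bounded[OF this \<psi> bound]
  have "integrable lebesgue (\<lambda>x. indicator K x *\<^sub>R w x * complex_of_real (\<psi> x))" .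
  also have "(\<lambda>x. indicator K x *\<^sub>R w x * complex_of_real (\<psi> x)) = (\<lambda>x. w x * complex_of_real (\<psi> x))"
    using K(2) by (auto simp: indicator_def fun_eq_iff)
  finally show ?thesis .
qed

lemma continuous_imp_borel_measurable_lebesgue:
  "continuous_on UNIV f \<Longrightarrow> f \<in> borel_measurable lebesgue"
  by (simp add: borel_measurable_continuous_onI measurable_completion)

lemma continuous_compact_support_bounded:
  fixes f :: "'a::topological_space \<Rightarrow> 'b::real_normed_vector"
  assumes "continuous_on UNIV f" "compact K" "\<And>x. x \<notin> K \<Longrightarrow> f x = 0"
  obtains M where "\<And>x. norm (f x) \<le> M"
proof -
  have "bounded (f ` K)"
    using assms by (intro compact_imp_bounded compact_continuous_image) (auto intro: continuous_on_subset)
  then obtain M where M: "\<And>x. x \<in> K \<Longrightarrow> norm (f x) \<le> M"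
    by (auto simp: bounded_iff)
  have "norm (f x) \<le> max M 0" for x
    using M[of x] assms(3)[of x] by (cases "x \<in> K") auto
  then show ?thesis using that by blast
qed

lemma test_function_continuous: "test_function \<phi> \<Longrightarrow> continuous_on UNIV \<phi>"
  by (metis C_k.simps(1) test_function_def)

lemma test_function_differentiable: "test_function \<phi> \<Longrightarrow> \<phi> differentiable (at x)"
  by (metis C_k.simps(2) UNIV_I differentiable_on_eq_differentiable_at open_UNIV test_function_def)

lemma test_function_pderivative_continuous: "test_function \<phi> \<Longrightarrow> continuous_on UNIV (pderivative i \<phi>)"
  by (metis C_k.simps test_function_def)

lemma pderivative_eq_0_outside_support:
  assumes "x \<notin> closure {x. \<phi> x \<noteq> 0}"
  shows "pderivative i \<phi> x = 0"
proof -
  have "((\<lambda>_. 0) has_derivative (\<lambda>_. 0)) (at x)" by simp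
  then have "(\<phi> has_derivative (\<lambda>_. 0)) (at x)"
    by (rule has_derivative_transform_within_open[of _ _ _ _ "- closure {x. \<phi> x \<noteq> 0}"])
      (use assms closure_subset[of "{x. \<phi> x \<noteq> 0}"] in auto)
  then show ?thesis by (simp add: pderivative_eq)
qed

lemma test_function_support:
  assumes "test_function \<phi>"
  obtains K where "compact K" "\<And>x. x \<notin> K \<Longrightarrow> \<phi> x = 0" "\<And>i x. x \<notin> K \<Longrightarrow> pderivative i \<phi> x = 0"
proof
  show "compact (closure {x. \<phi> x \<noteq> 0})"
    using assms by (simp add: test_function_def)
  show "\<phi> x = 0" if "x \<notin> closure {x. \<phi> x \<noteq> 0}" for x
    using that closure_subset[of "{x. \<phi> x \<noteq> 0}"] by blast
qed (rule pderivative_eq_0_outside_support)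

lemma test_function_bounded:
  assumes "test_function \<phi>"
  obtains M where "\<And>x. \<bar>\<phi> x\<bar> \<le> M"
proof -
  obtain K where "compact K" "\<And>x. x \<notin> K \<Longrightarrow> \<phi> x = 0"
    using test_function_support[OF assms] by metis
  then obtain M where "\<And>x. norm (\<phi> x) \<le> M"
    using continuous_compact_support_bounded[OF test_function_continuous[OF assms]] by metis
  then show ?thesis using that unfolding real_norm_def by blast
qed

lemma test_function_pderivative_bounded:
  assumes "test_function \<phi>"
  obtains M where "\<And>x. \<bar>pderivative i \<phi> x\<bar> \<le> M"
proof -
  obtain K where "compact K" "\<And>x. x \<notin> K \<Longrightarrow> pderivative i \<phi> x = 0"
    using test_function_support[OF assms] by metis
  then obtain M where "\<And>x. norm (pderivative i \<phi> x) \<le> M"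
    using continuous_compact_support_bounded[OF test_function_pderivative_continuous[OF assms]] by metis
  then show ?thesis using that unfolding real_norm_def by blast
qed

lemma integrable_mult_test_function:
  assumes "locally_integrable w" "test_function \<phi>"
  shows "integrable lebesgue (\<lambda>x. w x * complex_of_real (\<phi> x))"
    and "integrable lebesgue (\<lambda>x. w x * complex_of_real (pderivative i \<phi> x))"
proof -
  obtain K where K: "compact K" "\<And>x. x \<notin> K \<Longrightarrow> \<phi> x = 0" "\<And>i x. x \<notin> K \<Longrightarrow> pderivative i \<phi> x = 0"
    using test_function_support[OF assms(2)] by blast
  obtain M where M: "\<And>x. \<bar>\<phi> x\<bar> \<le> M"
    using test_function_bounded[OF assms(2)] by blast
  show "integrable lebesgue (\<lambda>x. w x * complex_of_real (\<phi> x))"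
    by (rule integrable_locally_integrable_mult[OF assms(1) _ M K(1,2)])
      (auto intro: continuous_imp_borel_measurable_lebesgue test_function_continuous assms)
  obtain M where M: "\<And>x. \<bar>pderivative i \<phi> x\<bar> \<le> M"
    using test_function_pderivative_bounded[OF assms(2)] by blast
  show "integrable lebesgue (\<lambda>x. w x * complex_of_real (pderivative i \<phi> x))"
    by (rule integrable_locally_integrable_mult[OF assms(1) _ M K(1,3)])
      (auto intro: continuous_imp_borel_measurable_lebesgue test_function_pderivative_continuous assms)
qed

lemma locally_integrable_diff:
  "locally_integrable f \<Longrightarrow> locally_integrable g \<Longrightarrow> locally_integrable (\<lambda>x. f x - g x)"
  unfolding locally_integrable_def by (blast intro: set_integral_diff(1))

text \<open>The difference of two weak derivatives annihilates all test functions. Letting these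
  increase to the fullness of a box, dominated convergence gives vanishing integrals over all
  boxes.\<close>

lemma has_weak_pderiv_unique:
  fixes w :: "real^'n \<Rightarrow> complex"
  assumes "has_weak_pderiv i w g" "has_weak_pderiv i w g'"
  shows "AE x in lebesgue. g x = g' x"
proof -
  define h where "h x = g x - g' x" for x
  have loc: "locally_integrable g" "locally_integrable g'" "locally_integrable h"
    using assms by (auto simp: has_weak_pderiv_def h_def[abs_def] locally_integrable_diff)
  have test0: "(LINT x|lebesgue. h x * complex_of_real (\<phi> x)) = 0" if "test_function \<phi>" for \<phi>
  proof -
    have "(LINT x|lebesgue. g x * complex_of_real (\<phi> x)) = (LINT x|lebesgue. g' x * complex_of_real (\<phi> x))"
      using assms[unfolded has_weak_pderiv_def, THEN conjunct2, THEN conjunct2, rule_format, OF that] by simp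
    then show ?thesis
      using that loc by (simp add: h_def left_diff_distrib integrable_mult_test_function)
  qed
  have "AE x in lebesgue. h x = 0"
  proof (rule AE_eq_0_if_box_integrals_0[OF loc(3)])
    fix a b :: "real^'n"
    obtain \<phi> where \<phi>: "\<And>m::nat. test_function (\<phi> m)"
      "\<And>m x. 0 \<le> \<phi> m x \<and> \<phi> m x \<le> indicator (box a b) x"
      "\<And>x. (\<lambda>m. \<phi> m x) \<longlonglongrightarrow> indicator (box a b) x"
      using ex_test_functions_tendsto_indicator_box[of a b] by metis
    have "set_integrable lebesgue (cbox a b) h"
      using loc(3) compact_cbox unfolding locally_integrable_def by blast
    then have "set_integrable lebesgue (box a b) h"
      by (rule set_integrable_subset) (auto simp: box_subset_cbox)
    then have I: "integrable lebesgue (\<lambda>x. indicator (box a b) x *\<^sub>R h x)"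
      by (simp add: set_integrable_def)
    have "(\<lambda>m. LINT x|lebesgue. h x * complex_of_real (\<phi> m x)) \<longlonglongrightarrow>
        (LINT x|lebesgue. indicator (box a b) x *\<^sub>R h x)"
    proof (rule integral_dominated_convergence)
      show "(\<lambda>x. indicator (box a b) x *\<^sub>R h x) \<in> borel_measurable lebesgue"
        using I by (rule borel_measurable_integrable)
      show "(\<lambda>x. h x * complex_of_real (\<phi> m x)) \<in> borel_measurable lebesgue" for m
        by (intro borel_measurable_integrable integrable_mult_test_function loc \<phi>)
      show "integrable lebesgue (\<lambda>x. norm (indicator (box a b) x *\<^sub>R h x))"
        using I by (rule integrable_norm)
      have "(\<lambda>m. h x * complex_of_real (\<phi> m x)) \<longlonglongrightarrow> h x * complex_of_real (indicator (box a b) x)" for x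
        by (intro tendsto_intros \<phi>)
      then show "AE x in lebesgue. (\<lambda>m. h x * complex_of_real (\<phi> m x)) \<longlonglongrightarrow> indicator (box a b) x *\<^sub>R h x"
        by (simp add: scaleR_conv_of_real mult.commute)
      have "norm (h x * complex_of_real (\<phi> m x)) \<le> norm (indicator (box a b) x *\<^sub>R h x)" for m x
        using \<phi>(2)[of m x] mult_right_mono[of "\<phi> m x" "indicator (box a b) x" "norm (h x)"]
        by (simp add: norm_mult mult.commute)
      then show "AE x in lebesgue. norm (h x * complex_of_real (\<phi> m x)) \<le> norm (indicator (box a b) x *\<^sub>R h x)" for m
        by simp
    qed
    then show "(LINT x:box a b|lebesgue. h x) = 0"
      by (simp add: test0[OF \<phi>(1)] set_lebesgue_integral_def LIMSEQ_const_iff)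
  qed
  then show ?thesis by eventually_elim (simp add: h_def)
qed

section \<open>Linear combinations and the chosen weak derivative\<close>

lemma locally_integrable_sum:
  fixes f :: "'k \<Rightarrow> 'a::euclidean_space \<Rightarrow> complex"
  assumes "\<And>k. k \<in> S \<Longrightarrow> locally_integrable (f k)"
  shows "locally_integrable (\<lambda>x. \<Sum>k\<in>S. c k * f k x)"
  using assms unfolding locally_integrable_def set_integrable_def
  by (auto simp: scaleR_sum_right simp flip: mult_scaleR_right
      intro!: Bochner_Integration.integrable_sum integrable_mult_right)

lemma has_weak_pderiv_sum:
  fixes w :: "'k \<Rightarrow> real^'n \<Rightarrow> complex"
  assumes "\<And>k. k \<in> S \<Longrightarrow> has_weak_pderiv i (w k) (g k)"
  shows "has_weak_pderiv i (\<lambda>x. \<Sum>k\<in>S. c k * w k x) (\<lambda>x. \<Sum>k\<in>S. c k * g k x)"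
  unfolding has_weak_pderiv_def
proof (intro conjI allI impI)
  have loc: "locally_integrable (w k)" "locally_integrable (g k)" if "k \<in> S" for k
    using assms[OF that] by (auto simp: has_weak_pderiv_def)
  then show "locally_integrable (\<lambda>x. \<Sum>k\<in>S. c k * w k x)" "locally_integrable (\<lambda>x. \<Sum>k\<in>S. c k * g k x)"
    by (auto intro: locally_integrable_sum)
  fix \<phi> :: "real^'n \<Rightarrow> real" assume \<phi>: "test_function \<phi>"
  have "(LINT x|lebesgue. (\<Sum>k\<in>S. c k * w k x) * complex_of_real (pderivative i \<phi> x)) =
      (LINT x|lebesgue. (\<Sum>k\<in>S. c k * (w k x * complex_of_real (pderivative i \<phi> x))))"
    by (simp add: sum_distrib_right mult.assoc)
  also have "\<dots> = (\<Sum>k\<in>S. c k * (LINT x|lebesgue. w k x * complex_of_real (pderivative i \<phi> x)))"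
    using loc by (simp add: integrable_mult_test_function \<phi>)
  also have "\<dots> = (\<Sum>k\<in>S. c k * - (LINT x|lebesgue. g k x * complex_of_real (\<phi> x)))"
    using assms \<phi> by (auto simp: has_weak_pderiv_def intro!: sum.cong)
  also have "\<dots> = - (\<Sum>k\<in>S. c k * (LINT x|lebesgue. g k x * complex_of_real (\<phi> x)))"
    by (simp add: sum_negf)
  also have "\<dots> = - (LINT x|lebesgue. (\<Sum>k\<in>S. c k * (g k x * complex_of_real (\<phi> x))))"
    using loc by (simp add: integrable_mult_test_function \<phi>)
  also have "\<dots> = - (LINT x|lebesgue. (\<Sum>k\<in>S. c k * g k x) * complex_of_real (\<phi> x))"
    by (simp add: sum_distrib_right mult.assoc)
  finally show "(LINT x|lebesgue. (\<Sum>k\<in>S. c k * w k x) * complex_of_real (pderivative i \<phi> x)) =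
     - (LINT x|lebesgue. (\<Sum>k\<in>S. c k * g k x) * complex_of_real (\<phi> x))" .
qed

text \<open>This is the bridge from the version selected by \<open>SOME\<close> to an explicit one:
  inside integrals the two are interchangeable.\<close>

lemma weak_pderiv_AE_eq:
  assumes "has_weak_pderiv i w g"
  shows "AE x in lebesgue. weak_pderiv i w x = g x"
  using has_weak_pderiv_unique[OF _ assms] someI[of "has_weak_pderiv i w", OF assms]
  unfolding weak_pderiv_def by blast

section \<open>Weak derivatives of Lipschitz functions\<close>

lemma lborel_integral_translation:
  fixes f :: "'a::euclidean_space \<Rightarrow> 'b::{banach, second_countable_topology}"
  assumes [measurable]: "f \<in> borel_measurable borel"
  shows "(LINT x|lborel. f (c + x)) = (LINT x|lborel. f x)"
proof -
  have "(LINT x|lborel. f x) = (LINT x|distr lborel borel ((+) c). f x)"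
    by (simp add: lborel_distr_plus)
  also have "\<dots> = (LINT x|lborel. f (c + x))"
    by (rule integral_distr) auto
  finally show ?thesis ..
qed

lemma lebesgue_integral_translation:
  fixes f :: "'a::euclidean_space \<Rightarrow> 'b::{banach, second_countable_topology}"
  assumes [measurable]: "f \<in> borel_measurable borel"
  shows "(LINT x|lebesgue. f (c + x)) = (LINT x|lebesgue. f x)"
  using lborel_integral_translation[OF assms, of c] by (simp add: integral_completion)

lemma continuous_imp_locally_integrable:
  fixes f :: "'a::euclidean_space \<Rightarrow> 'b::euclidean_space"
  assumes "continuous_on UNIV f"
  shows "locally_integrable f"
  unfolding locally_integrable_def
proof (intro allI impI)
  fix K :: "'a set" assume K: "compact K"
  then obtain a where a: "K \<subseteq> cbox (- a) a"
    using compact_imp_bounded bounded_subset_cbox_symmetric by blast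
  have "f absolutely_integrable_on cbox (- a) a"
    using assms by (intro absolutely_integrable_continuous) (auto intro: continuous_on_subset)
  then show "f absolutely_integrable_on K"
    using lmeasurable_compact[OF K] a by (auto intro: set_integrable_subset simp: fmeasurable_def)
qed

lemma bounded_imp_locally_integrable:
  fixes g :: "'a::euclidean_space \<Rightarrow> complex"
  assumes "g \<in> borel_measurable lebesgue" "AE x in lebesgue. norm (g x) \<le> M"
  shows "locally_integrable g"
  unfolding locally_integrable_def set_integrable_def
proof (intro allI impI)
  fix K :: "'a set" assume K: "compact K"
  show "integrable lebesgue (\<lambda>x. indicator K x *\<^sub>R g x)"
  proof (rule Bochner_Integration.integrable_bound)
    have "K \<in> lmeasurable" using K by (rule lmeasurable_compact)
    then show "integrable lebesgue (\<lambda>x. M * indicator K x)"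
      by (intro integrable_mult_right integrable_real_indicator) (auto simp: fmeasurable_def)
    show "(\<lambda>x. indicator K x *\<^sub>R g x) \<in> borel_measurable lebesgue"
      using lmeasurable_compact[OF K] assms(1)
      by (intro borel_measurable_scaleR borel_measurable_indicator) (auto simp: fmeasurable_def)
    show "AE x in lebesgue. norm (indicator K x *\<^sub>R g x) \<le> norm (M * indicator K x)"
      using assms(2) by eventually_elim (auto simp: indicator_def)
  qed
qed

lemma test_function_has_real_derivative_along_axis:
  assumes "test_function \<phi>"
  shows "((\<lambda>s. \<phi> (x + s *\<^sub>R axis i 1)) has_real_derivative pderivative i \<phi> (x + s *\<^sub>R axis i 1)) (at s)"
proof -
  have "((\<lambda>s. x + s *\<^sub>R axis i 1) has_derivative (\<lambda>s. s *\<^sub>R axis i 1)) (at s)"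
    by (auto intro!: derivative_eq_intros)
  moreover have "(\<phi> has_derivative frechet_derivative \<phi> (at (x + s *\<^sub>R axis i 1))) (at (x + s *\<^sub>R axis i 1))"
    using test_function_differentiable[OF assms] by (simp add: frechet_derivative_works)
  ultimately have "((\<lambda>s. \<phi> (x + s *\<^sub>R axis i 1)) has_derivative
      (\<lambda>h. frechet_derivative \<phi> (at (x + s *\<^sub>R axis i 1)) (h *\<^sub>R axis i 1))) (at s)"
    by (rule has_derivative_compose)
  moreover have "frechet_derivative \<phi> (at (x + s *\<^sub>R axis i 1)) (h *\<^sub>R axis i 1) =
      pderivative i \<phi> (x + s *\<^sub>R axis i 1) * h" for h
    using linear_frechet_derivative[OF test_function_differentiable[OF assms]]
    by (simp add: linear_scale pderivative_def)
  ultimately show ?thesis by (simp add: has_field_derivative_def)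
qed

text \<open>Mean value theorem on the segment from \<open>x - h *\<^sub>R axis i 1\<close> to
  \<open>x\<close>. The bound does not depend on \<open>x\<close>, so it can serve as a dominating
  constant.\<close>

lemma test_function_diff_quotient_bound:
  assumes "test_function \<phi>" "\<And>x. \<bar>pderivative i \<phi> x\<bar> \<le> M" "h > 0"
  shows "\<bar>\<phi> (x - h *\<^sub>R axis i 1) - \<phi> x\<bar> \<le> M * h"
proof -
  have "\<exists>z>- h. z < 0 \<and> \<phi> (x + 0 *\<^sub>R axis i 1) - \<phi> (x + (- h) *\<^sub>R axis i 1) =
      (0 - (- h)) * pderivative i \<phi> (x + z *\<^sub>R axis i 1)"
    using assms test_function_has_real_derivative_along_axis by (intro MVT2) auto
  then obtain z where "\<phi> x - \<phi> (x - h *\<^sub>R axis i 1) = h * pderivative i \<phi> (x + z *\<^sub>R axis i 1)"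
    by auto
  then have "\<bar>\<phi> (x - h *\<^sub>R axis i 1) - \<phi> x\<bar> = \<bar>pderivative i \<phi> (x + z *\<^sub>R axis i 1)\<bar> * h"
    using assms(3) by (simp add: abs_minus_commute abs_mult mult.commute)
  then show ?thesis using assms by (simp add: mult_right_mono)
qed

text \<open>Translation invariance moves the difference quotient from \<open>w\<close> to the test function; both
  sides then converge by dominated convergence.\<close>

lemma has_weak_pderiv_lipschitz:
  fixes w :: "real^'n \<Rightarrow> complex"
  assumes lip: "L-lipschitz_on UNIV w" and supp: "bounded {x. w x \<noteq> 0}"
    and g: "g \<in> borel_measurable lebesgue"
    and deriv: "AE x in lebesgue.
      ((\<lambda>h. (w (x + h *\<^sub>R axis i 1) - w x) / complex_of_real h) \<longlongrightarrow> g x) (at 0)"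
  shows "has_weak_pderiv i w g"
  unfolding has_weak_pderiv_def
proof (intro conjI allI impI)
  define h where "h m = inverse (real (Suc m))" for m
  have h: "h m > 0" for m by (simp add: h_def)
  have h0: "h \<longlonglongrightarrow> 0" unfolding h_def by (rule LIMSEQ_inverse_real_of_nat)
  have h0': "filterlim h (at 0) sequentially"
    using h h0 by (simp add: filterlim_at less_imp_neq[symmetric])
  have h0'': "filterlim (\<lambda>m. - h m) (at 0) sequentially"
    using h tendsto_minus[OF h0] by (simp add: filterlim_at less_imp_neq[symmetric])
  define D where "D m x = (w (x + h m *\<^sub>R axis i 1) - w x) / complex_of_real (h m)" for m x
  have lip': "norm (w x - w y) \<le> L * norm (x - y)" for x y
    using lipschitz_onD[OF lip, of x y] by (simp add: dist_norm)
  have D_le: "norm (D m x) \<le> L" for m x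
    using lip'[of "x + h m *\<^sub>R axis i 1" x] h[of m] by (simp add: D_def norm_divide norm_axis_1 field_simps)
  have D_lim: "AE x in lebesgue. (\<lambda>m. D m x) \<longlonglongrightarrow> g x"
    using deriv unfolding D_def
    by eventually_elim (rule filterlim_compose[OF _ h0'])
  have contw: "continuous_on UNIV w"
    using lip by (rule lipschitz_on_continuous_on)
  have contD: "continuous_on UNIV (D m)" for m
    unfolding D_def using h[of m]
    by (intro continuous_intros continuous_on_compose2[OF contw]) auto
  show locw: "locally_integrable w"
    using contw by (rule continuous_imp_locally_integrable)
  have "AE x in lebesgue. norm (g x) \<le> L"
    using D_lim
  proof eventually_elim
    case (elim x)
    then show ?case by (intro Lim_norm_ubound[OF _ elim]) (auto simp: D_le)
  qed
  then show locg: "locally_integrable g"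
    by (rule bounded_imp_locally_integrable[OF g])
  fix \<phi> :: "real^'n \<Rightarrow> real" assume \<phi>: "test_function \<phi>"
  obtain M where M: "\<And>x. \<bar>pderivative i \<phi> x\<bar> \<le> M"
    using test_function_pderivative_bounded[OF \<phi>] by blast
  have cont\<phi>: "continuous_on UNIV \<phi>" by (rule test_function_continuous[OF \<phi>])
  obtain M' where M': "\<And>x. \<bar>\<phi> x\<bar> \<le> M'"
    using test_function_bounded[OF \<phi>] by blast
  \<comment> \<open>Translating the forward quotient of \<open>w\<close> by \<open>h m\<close>
    produces the backward numerator of \<open>\<phi>\<close>, with limit
    \<open>- pderivative i \<phi>\<close>. This is the origin of the minus sign in the definition of
    a weak derivative.\<close>
  define E where "E m x = (\<phi> (x - h m *\<^sub>R axis i 1) - \<phi> x) / h m" for m x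
  have contE: "continuous_on UNIV (E m)" for m
    unfolding E_def using h[of m]
    by (intro continuous_intros continuous_on_compose2[OF cont\<phi>]) auto
  have E_le: "\<bar>E m x\<bar> \<le> M" for m x
    using test_function_diff_quotient_bound[OF \<phi> M h, of x m] h[of m] by (simp add: E_def field_simps)
  have E_lim: "(\<lambda>m. E m x) \<longlonglongrightarrow> - pderivative i \<phi> x" for x
  proof -
    have "((\<lambda>s. (\<phi> (x + (0 + s) *\<^sub>R axis i 1) - \<phi> (x + 0 *\<^sub>R axis i 1)) / s) \<longlongrightarrow> pderivative i \<phi> (x + 0 *\<^sub>R axis i 1)) (at 0)"
      using test_function_has_real_derivative_along_axis[OF \<phi>, of x i 0]
      unfolding DERIV_def .
    from tendsto_minus[OF filterlim_compose[OF this h0'']] show ?thesis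
      by (simp add: E_def)
  qed
  have int1: "integrable lebesgue (\<lambda>x. w x * complex_of_real (\<phi> x))"
    by (rule integrable_mult_test_function[OF locw \<phi>])
  have loc1: "locally_integrable (\<lambda>x::real^'n. 1::complex)"
    by (intro continuous_imp_locally_integrable continuous_intros)
  have int\<phi>: "integrable lebesgue (\<lambda>x. complex_of_real (\<phi> x))"
    using integrable_mult_test_function(1)[OF loc1 \<phi>] by simp
  obtain r where r: "\<And>x. w x \<noteq> 0 \<Longrightarrow> norm x \<le> r"
    using supp by (auto simp: bounded_iff)
  then have "\<And>x. x \<notin> cball 0 r \<Longrightarrow> w x = 0" by force
  then have "(\<lambda>x. indicator (cball 0 r) x *\<^sub>R w x) = w"
    by (auto simp: indicator_def fun_eq_iff)
  moreover have "set_integrable lebesgue (cball 0 r) w"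
    using locw unfolding locally_integrable_def by simp
  ultimately have intw: "integrable lebesgue w"
    by (simp add: set_integrable_def)
  \<comment> \<open>Integration by parts for difference quotients, exact for every
    \<open>m\<close>.\<close>
  have parts: "(LINT x|lebesgue. D m x * complex_of_real (\<phi> x)) = (LINT x|lebesgue. w x * complex_of_real (E m x))" for m
  proof -
    let ?e = "h m *\<^sub>R axis i 1 :: real^'n"
    have cont: "continuous_on UNIV (\<lambda>x. w x * complex_of_real (\<phi> (x - ?e)))"
      by (intro continuous_intros continuous_on_compose2[OF cont\<phi>] contw) auto
    have tr: "(LINT x|lebesgue. w (?e + x) * complex_of_real (\<phi> x)) = (LINT x|lebesgue. w x * complex_of_real (\<phi> (x - ?e)))"
      using lebesgue_integral_translation[OF borel_measurable_continuous_onI[OF cont], of ?e] by simp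
    have "continuous_on UNIV (\<lambda>x. w (?e + x))"
      by (intro continuous_intros continuous_on_compose2[OF contw]) auto
    then have intD: "integrable lebesgue (\<lambda>x. w (?e + x) * complex_of_real (\<phi> x))"
      by (intro integrable_mult_test_function(1)[OF _ \<phi>] continuous_imp_locally_integrable)
    have intE: "integrable lebesgue (\<lambda>x. w x * complex_of_real (\<phi> (x - ?e)))"
      by (rule integrable_mult_bounded[OF intw _ M'])
        (intro continuous_imp_borel_measurable_lebesgue continuous_on_compose2[OF cont\<phi>] continuous_intros, auto)
    have "(LINT x|lebesgue. D m x * complex_of_real (\<phi> x)) =
        (LINT x|lebesgue. (w (?e + x) * complex_of_real (\<phi> x) - w x * complex_of_real (\<phi> x)) / complex_of_real (h m))"
      by (simp add: D_def algebra_simps diff_divide_distrib)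
    also have "\<dots> = ((LINT x|lebesgue. w x * complex_of_real (\<phi> (x - ?e))) -
        (LINT x|lebesgue. w x * complex_of_real (\<phi> x))) / complex_of_real (h m)"
      using intD int1 by (simp add: tr)
    also have "\<dots> = (LINT x|lebesgue. (w x * complex_of_real (\<phi> (x - ?e)) - w x * complex_of_real (\<phi> x)) / complex_of_real (h m))"
      using intE int1 by simp
    also have "\<dots> = (LINT x|lebesgue. w x * complex_of_real (E m x))"
      by (simp add: E_def algebra_simps diff_divide_distrib)
    finally show ?thesis .
  qed
  have measE: "(\<lambda>x. w x * complex_of_real (E m x)) \<in> borel_measurable lebesgue" for m
    by (intro continuous_imp_borel_measurable_lebesgue continuous_intros contw contE)
  have "(\<lambda>m. LINT x|lebesgue. D m x * complex_of_real (\<phi> x)) \<longlonglongrightarrow> (LINT x|lebesgue. g x * complex_of_real (\<phi> x))"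
  proof (rule integral_dominated_convergence)
    show "integrable lebesgue (\<lambda>x. L * norm (complex_of_real (\<phi> x)))"
      using int\<phi> by (intro integrable_mult_right integrable_norm)
    show "(\<lambda>x. g x * complex_of_real (\<phi> x)) \<in> borel_measurable lebesgue"
      by (intro borel_measurable_integrable integrable_mult_test_function locg \<phi>)
    show "(\<lambda>x. D m x * complex_of_real (\<phi> x)) \<in> borel_measurable lebesgue" for m
      by (intro continuous_imp_borel_measurable_lebesgue continuous_intros contD cont\<phi>)
    show "AE x in lebesgue. (\<lambda>m. D m x * complex_of_real (\<phi> x)) \<longlonglongrightarrow> g x * complex_of_real (\<phi> x)"
      using D_lim by eventually_elim (intro tendsto_intros)
    show "AE x in lebesgue. norm (D m x * complex_of_real (\<phi> x)) \<le> L * norm (complex_of_real (\<phi> x))" for m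
      using D_le by (simp add: norm_mult mult_right_mono)
  qed
  moreover have "(\<lambda>m. LINT x|lebesgue. w x * complex_of_real (E m x)) \<longlonglongrightarrow>
      (LINT x|lebesgue. w x * complex_of_real (- pderivative i \<phi> x))"
  proof (rule integral_dominated_convergence)
    show "integrable lebesgue (\<lambda>x. norm (w x) * M)"
      using intw by (intro integrable_mult_left integrable_norm)
    show "(\<lambda>x. w x * complex_of_real (- pderivative i \<phi> x)) \<in> borel_measurable lebesgue"
      by (intro continuous_imp_borel_measurable_lebesgue continuous_intros contw
          test_function_pderivative_continuous \<phi>)
    show "(\<lambda>x. w x * complex_of_real (E m x)) \<in> borel_measurable lebesgue" for m
      by (rule measE)
    show "AE x in lebesgue. (\<lambda>m. w x * complex_of_real (E m x)) \<longlonglongrightarrow> w x * complex_of_real (- pderivative i \<phi> x)"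
      by (intro AE_I2 tendsto_intros E_lim)
    show "AE x in lebesgue. norm (w x * complex_of_real (E m x)) \<le> norm (w x) * M" for m
      using E_le by (simp add: norm_mult mult_left_mono)
  qed
  ultimately have "(LINT x|lebesgue. g x * complex_of_real (\<phi> x)) = (LINT x|lebesgue. w x * complex_of_real (- pderivative i \<phi> x))"
    unfolding parts by (rule LIMSEQ_unique)
  then show "(LINT x|lebesgue. w x * complex_of_real (pderivative i \<phi> x)) = - (LINT x|lebesgue. g x * complex_of_real (\<phi> x))"
    by simp
qed

section \<open>The logarithmic cutoff\<close>

definition log_cutoff :: "'a::real_normed_vector \<Rightarrow> real \<Rightarrow> real \<Rightarrow> 'a \<Rightarrow> real"
  where "log_cutoff c r R x = ln R - ln (max r (min R (norm (x - c))))"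

text \<open>The classical partial derivative off the two spheres of radius \<open>r\<close> and
  \<open>R\<close>. On the spheres the value 0 is arbitrary, as they are null sets.\<close>

definition log_cutoff_grad :: "real^'n \<Rightarrow> real \<Rightarrow> real \<Rightarrow> 'n \<Rightarrow> real^'n \<Rightarrow> real"
  where "log_cutoff_grad c r R i x =
    (if r < norm (x - c) \<and> norm (x - c) < R then - ((x - c) $ i / (norm (x - c))\<^sup>2) else 0)"

text \<open>Clamping the distance to the interval from \<open>r\<close> to \<open>R\<close> does not
  increase differences, and on \<open>[r, \<infinity>)\<close> the logarithm has slope at most
  \<open>1 / r\<close>.\<close>

lemma log_cutoff_lipschitz:
  assumes "0 < r" "r < R"
  shows "(1 / r)-lipschitz_on UNIV (log_cutoff c r R)"
proof (rule lipschitz_onI)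
  define \<rho> where "\<rho> s = max r (min R s)" for s
  have \<rho>: "\<rho> s \<ge> r" for s by (simp add: \<rho>_def)
  have *: "ln (\<rho> s) - ln (\<rho> t) \<le> \<bar>s - t\<bar> / r" for s t
  proof (cases "\<rho> t \<le> \<rho> s")
    case True
    have "ln (\<rho> s) - ln (\<rho> t) \<le> (\<rho> s - \<rho> t) / \<rho> t"
      using \<rho>[of s] \<rho>[of t] assms by (intro ln_diff_le) auto
    also have "\<dots> \<le> (\<rho> s - \<rho> t) / r"
      using True \<rho>[of t] assms by (intro divide_left_mono) auto
    also have "\<dots> \<le> \<bar>s - t\<bar> / r"
      using assms by (intro divide_right_mono) (auto simp: \<rho>_def)
    finally show ?thesis .
  next
    case False
    then have "ln (\<rho> s) \<le> ln (\<rho> t)"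
      using \<rho>[of s] assms by (subst ln_le_cancel_iff) auto
    moreover have "0 \<le> \<bar>s - t\<bar> / r" using assms by simp
    ultimately show ?thesis by linarith
  qed
  fix x y :: 'a
  have "\<bar>norm (x - c) - norm (y - c)\<bar> \<le> norm (x - y)"
    using norm_triangle_ineq3[of "x - c" "y - c"] by simp
  then have "\<bar>norm (x - c) - norm (y - c)\<bar> / r \<le> norm (x - y) / r"
    using assms by (intro divide_right_mono) auto
  then show "dist (log_cutoff c r R x) (log_cutoff c r R y) \<le> 1 / r * dist x y"
    using *[of "norm (x - c)" "norm (y - c)"] *[of "norm (y - c)" "norm (x - c)"]
    by (simp add: log_cutoff_def \<rho>_def dist_norm abs_minus_commute) linarith
qed (use assms in simp)

lemma log_cutoff_inner:
  assumes "0 < r" "r < R" "norm (x - c) \<le> r"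
  shows "log_cutoff c r R x = ln (R / r)"
  using assms by (simp add: log_cutoff_def ln_div min_absorb2 max_absorb1)

lemma log_cutoff_outer:
  assumes "0 < r" "r < R" "R \<le> norm (x - c)"
  shows "log_cutoff c r R x = 0"
  using assms by (simp add: log_cutoff_def min_absorb1 max_absorb2)

lemma log_cutoff_bounds:
  assumes "0 < r" "r < R"
  shows "0 \<le> log_cutoff c r R x \<and> log_cutoff c r R x \<le> ln (R / r)"
  using assms by (auto simp: log_cutoff_def ln_div max_def min_def)

lemma norm_add_axis_squared:
  fixes y :: "real^'n"
  shows "(norm (y + s *\<^sub>R axis i 1))\<^sup>2 = (norm y)\<^sup>2 + 2 * s * y $ i + s\<^sup>2"
  unfolding power2_norm_eq_inner
  by (simp add: inner_add_left inner_add_right inner_axis inner_axis' power2_eq_square algebra_simps)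

lemma log_cutoff_has_derivative_along_axis:
  fixes c :: "real^'n"
  assumes "0 < r" "r < R" "norm (x - c) \<noteq> r" "norm (x - c) \<noteq> R"
  shows "((\<lambda>s. log_cutoff c r R (x + s *\<^sub>R axis i 1)) has_real_derivative log_cutoff_grad c r R i x) (at 0)"
proof -
  let ?n = "\<lambda>s. norm (x + s *\<^sub>R axis i 1 - c)"
  have cont: "continuous_on UNIV ?n" by (intro continuous_intros)
  consider "norm (x - c) < r" | "r < norm (x - c)" "norm (x - c) < R" | "R < norm (x - c)"
    using assms by linarith
  then show ?thesis
  proof cases
    case 1
    have "open {s. ?n s < r}" by (intro open_Collect_less cont continuous_intros)
    then have "((\<lambda>s. log_cutoff c r R (x + s *\<^sub>R axis i 1)) has_real_derivative 0) (at 0)"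
      using 1 assms(1,2)
      by (intro has_field_derivative_transform_within_open[OF DERIV_const[of "ln (R / r)"]])
        (auto simp: log_cutoff_inner)
    then show ?thesis using 1 by (simp add: log_cutoff_grad_def)
  next
    case 3
    have "open {s. R < ?n s}" by (intro open_Collect_less cont continuous_intros)
    then have "((\<lambda>s. log_cutoff c r R (x + s *\<^sub>R axis i 1)) has_real_derivative 0) (at 0)"
      using 3 assms(1,2)
      by (intro has_field_derivative_transform_within_open[OF DERIV_const[of 0]])
        (auto simp: log_cutoff_outer)
    then show ?thesis using 3 by (simp add: log_cutoff_grad_def)
  next
    case 2
    let ?y = "x - c"
    \<comment> \<open>Along an axis the squared distance is a quadratic polynomial in
      \<open>s\<close>. Writing the logarithm of the distance as half the logarithm of its square
      avoids differentiating the norm.\<close>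
    have n2: "(?n s)\<^sup>2 = (norm ?y)\<^sup>2 + 2 * s * ?y $ i + s\<^sup>2" for s
      using norm_add_axis_squared[of ?y s i] by (simp add: add_diff_eq diff_add_eq)
    have pos: "(norm ?y)\<^sup>2 > 0" using 2 assms by auto
    have D: "((\<lambda>s. ln R - ln ((norm ?y)\<^sup>2 + 2 * s * ?y $ i + s\<^sup>2) / 2) has_real_derivative
        - (?y $ i / (norm ?y)\<^sup>2)) (at 0)"
      using pos by (auto intro!: derivative_eq_intros simp: field_simps)
    have O: "open {s. r < ?n s \<and> ?n s < R}"
      by (intro open_Collect_conj open_Collect_less cont continuous_intros)
    have E: "ln R - ln ((norm ?y)\<^sup>2 + 2 * s * ?y $ i + s\<^sup>2) / 2 = log_cutoff c r R (x + s *\<^sub>R axis i 1)"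
      if "s \<in> {s. r < ?n s \<and> ?n s < R}" for s
      using that assms unfolding n2[symmetric] log_cutoff_def by (simp add: ln_realpow)
    have "((\<lambda>s. log_cutoff c r R (x + s *\<^sub>R axis i 1)) has_real_derivative
        - (?y $ i / (norm ?y)\<^sup>2)) (at 0)"
      by (rule has_field_derivative_transform_within_open[OF D O _ E])
        (use 2 in auto)
    then show ?thesis using 2 by (simp add: log_cutoff_grad_def)
  qed
qed

lemma log_cutoff_grad_measurable [measurable]:
  "log_cutoff_grad c r R i \<in> borel_measurable borel"
proof -
  have [measurable]: "(\<lambda>x. (x - c) $ i) \<in> borel_measurable borel"
    by (intro borel_measurable_continuous_onI continuous_intros)
  show ?thesis unfolding log_cutoff_grad_def[abs_def] by measurable
qed

lemma has_weak_pderiv_log_cutoff: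
  fixes c :: "real^'n"
  assumes "0 < r" "r < R"
  shows "has_weak_pderiv i (\<lambda>x. complex_of_real (log_cutoff c r R x))
    (\<lambda>x. complex_of_real (log_cutoff_grad c r R i x))"
proof (rule has_weak_pderiv_lipschitz)
  show "(1 / r)-lipschitz_on UNIV (\<lambda>x. complex_of_real (log_cutoff c r R x))"
    using log_cutoff_lipschitz[OF assms, of c]
    by (simp add: lipschitz_on_def dist_norm norm_of_real flip: of_real_diff)
  show "bounded {x. complex_of_real (log_cutoff c r R x) \<noteq> 0}"
    by (rule bounded_subset[OF bounded_ball[of c R]])
      (use log_cutoff_outer[OF assms] in \<open>force simp: dist_norm norm_minus_commute\<close>)
  show "(\<lambda>x. complex_of_real (log_cutoff_grad c r R i x)) \<in> borel_measurable lebesgue"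
    by (rule measurable_completion) measurable
  have "AE x in lebesgue. x \<notin> sphere c r \<union> sphere c R"
    by (intro AE_not_in) (simp add: negligible_sphere flip: negligible_iff_null_sets)
  then show "AE x in lebesgue. ((\<lambda>h. (complex_of_real (log_cutoff c r R (x + h *\<^sub>R axis i 1)) -
      complex_of_real (log_cutoff c r R x)) / complex_of_real h)
      \<longlongrightarrow> complex_of_real (log_cutoff_grad c r R i x)) (at 0)"
  proof eventually_elim
    case (elim x)
    then have "((\<lambda>s. log_cutoff c r R (x + s *\<^sub>R axis i 1)) has_real_derivative log_cutoff_grad c r R i x) (at 0)"
      using assms by (intro log_cutoff_has_derivative_along_axis) (auto simp: dist_norm norm_minus_commute)
    then have "((\<lambda>h. complex_of_real ((log_cutoff c r R (x + h *\<^sub>R axis i 1) - log_cutoff c r R x) / h))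
        \<longlongrightarrow> complex_of_real (log_cutoff_grad c r R i x)) (at 0)"
      by (intro tendsto_of_real) (simp add: DERIV_def)
    then show ?case by simp
  qed
qed

section \<open>Energy of the cutoff\<close>

lemma sum_log_cutoff_grad_squares:
  fixes c :: "real^'n"
  assumes "0 < r"
  shows "(\<Sum>i\<in>UNIV. (log_cutoff_grad c r R i x)\<^sup>2) =
    (if r < norm (x - c) \<and> norm (x - c) < R then 1 / (norm (x - c))\<^sup>2 else 0)"
proof (cases "r < norm (x - c) \<and> norm (x - c) < R")
  case True
  have "(\<Sum>i\<in>UNIV. ((x - c) $ i / (norm (x - c))\<^sup>2)\<^sup>2) = (\<Sum>i\<in>UNIV. ((x - c) $ i)\<^sup>2) / ((norm (x - c))\<^sup>2)\<^sup>2"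
    by (simp add: power_divide sum_divide_distrib)
  also have "(\<Sum>i\<in>UNIV. ((x - c) $ i)\<^sup>2) = (norm (x - c))\<^sup>2"
    unfolding power2_norm_eq_inner by (simp add: inner_vec_def power2_eq_square)
  also have "(norm (x - c))\<^sup>2 / ((norm (x - c))\<^sup>2)\<^sup>2 = 1 / (norm (x - c))\<^sup>2"
    by (simp add: power2_eq_square)
  finally show ?thesis using True by (simp add: log_cutoff_grad_def)
next
  case False
  then have "log_cutoff_grad c r R i x = 0" for i
    unfolding log_cutoff_grad_def by (rule if_not_P)
  then show ?thesis by (simp only: if_not_P[OF False]) simp
qed

text \<open>A substitute for polar coordinates. If \<open>\<rho>\<close> lies between
  \<open>R / 2 ^ Suc j\<close> and \<open>R / 2 ^ j\<close>, the \<open>j\<close>-th summand alone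
  dominates \<open>1 / \<rho>^2\<close> and the others are non-negative. The induction on
  \<open>n\<close> adds one dyadic layer at a time.\<close>

lemma inverse_square_le_dyadic_sum:
  fixes \<rho> R :: real
  assumes "0 < R" "R / 2 ^ n \<le> \<rho>" "\<rho> < R"
  shows "1 / \<rho>\<^sup>2 \<le> (\<Sum>j<n. 4 ^ Suc j / R\<^sup>2 * (if \<rho> < R / 2 ^ j then 1 else 0))"
  using assms
proof (induction n)
  case (Suc n)
  let ?s = "\<Sum>j<n. 4 ^ Suc j / R\<^sup>2 * (if \<rho> < R / 2 ^ j then 1 else (0::real))"
  have s0: "0 \<le> ?s" by (intro sum_nonneg) auto
  have \<rho>: "\<rho> > 0" using Suc.prems by (smt (verit) divide_pos_pos zero_less_power)
  have last: "1 / \<rho>\<^sup>2 \<le> 4 ^ Suc n / R\<^sup>2"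
  proof -
    have "(R / 2 ^ Suc n)\<^sup>2 \<le> \<rho>\<^sup>2"
      using Suc.prems by (intro power_mono) auto
    then have "1 / \<rho>\<^sup>2 \<le> 1 / (R / 2 ^ Suc n)\<^sup>2"
      using Suc.prems \<rho> by (intro divide_left_mono) auto
    also have "\<dots> = 4 ^ Suc n / R\<^sup>2"
      using power_mult_distrib[of "2::real" 2 "Suc n"] by (simp add: power_divide power2_eq_square)
    finally show ?thesis .
  qed
  show ?case
  proof (cases "\<rho> < R / 2 ^ n")
    case True
    then show ?thesis using last s0 by simp
  next
    case False
    then show ?thesis using Suc by simp
  qed
qed auto

lemma measure_lebesgue_ball:
  fixes c :: "real^2"
  assumes "0 \<le> r"
  shows "measure lebesgue (ball c r) = pi * r\<^sup>2"
  using content_ball[OF assms, of c] by (simp add: unit_ball_vol_2)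

text \<open>Every dyadic disc contributes \<open>4 ^ Suc j / R^2\<close> times the area
  \<open>pi * R^2 / 4 ^ j\<close>, that is \<open>4 * pi\<close>, and there are \<open>n\<close> of
  them. The exact energy would be \<open>2 * pi * n * ln 2\<close>; only the order in
  \<open>n\<close> matters, and the constant 16 in the depth of the wells absorbs the loss.\<close>

lemma log_cutoff_energy:
  fixes c :: "real^2"
  assumes "0 < R" "n > 0"
  defines "e \<equiv> \<lambda>x. \<Sum>i\<in>UNIV. (log_cutoff_grad c (R / 2 ^ n) R i x)\<^sup>2"
  shows "integrable lebesgue e" and "(LINT x|lebesgue. e x) \<le> 4 * pi * n"
proof -
  define d where "d x = (\<Sum>j<n. 4 ^ Suc j / R\<^sup>2 * indicat_real (ball c (R / 2 ^ j)) x)" for x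
  have ind: "integrable lebesgue (indicat_real (ball c s))" for s
    using lmeasurable_ball[of c s] by (intro integrable_real_indicator) (auto simp: fmeasurable_def)
  have d: "integrable lebesgue d"
    unfolding d_def by (intro Bochner_Integration.integrable_sum integrable_mult_right ind)
  have le: "0 \<le> e x \<and> e x \<le> d x" for x
  proof -
    have e: "e x = (if R / 2 ^ n < norm (x - c) \<and> norm (x - c) < R then 1 / (norm (x - c))\<^sup>2 else 0)"
      unfolding e_def using assms by (intro sum_log_cutoff_grad_squares) auto
    have d': "d x = (\<Sum>j<n. 4 ^ Suc j / R\<^sup>2 * (if norm (x - c) < R / 2 ^ j then 1 else 0))"
      unfolding d_def by (intro sum.cong) (auto simp: indicator_def dist_norm norm_minus_commute)
    have "0 \<le> d x" unfolding d_def by (intro sum_nonneg) auto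
    then show ?thesis
      using inverse_square_le_dyadic_sum[OF assms(1), of n "norm (x - c)"] unfolding e d' by auto
  qed
  have "e \<in> borel_measurable lebesgue"
    unfolding e_def by (rule measurable_completion) measurable
  then show e: "integrable lebesgue e"
  proof (rule Bochner_Integration.integrable_bound[OF d])
    have "norm (e x) \<le> norm (d x)" for x using le[of x] by simp
    then show "AE x in lebesgue. norm (e x) \<le> norm (d x)" by simp
  qed
  have "(LINT x|lebesgue. e x) \<le> (LINT x|lebesgue. d x)"
    using e d le by (intro integral_mono) auto
  also have "\<dots> = (\<Sum>j<n. 4 ^ Suc j / R\<^sup>2 * measure lebesgue (ball c (R / 2 ^ j)))"
    unfolding d_def using ind by (simp add: integral_indicator)
  also have "\<dots> = (\<Sum>j<n. 4 * pi)"
  proof (rule sum.cong)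
    fix j
    show "4 ^ Suc j / R\<^sup>2 * measure lebesgue (ball c (R / 2 ^ j)) = 4 * pi"
      using assms power_mult_distrib[of "2::real" 2 j]
      by (subst measure_lebesgue_ball) (auto simp: power_divide power2_eq_square)
  qed simp
  finally show "(LINT x|lebesgue. e x) \<le> 4 * pi * n" by (simp add: mult.commute)
qed

section \<open>Orlicz norm and choice of the wells\<close>

text \<open>Near 0 from the right, \<open>\<Psi> s\<close> is the product of
  \<open>\<Psi> s / s\<close> and \<open>s\<close>, both tending to 0. It serves to make
  \<open>\<Psi>\<close> of the potential vanish outside the wells.\<close>

lemma N_function_0:
  assumes "N_function \<Psi>"
  shows "\<Psi> 0 = 0"
proof -
  have cont: "(\<Psi> \<longlongrightarrow> \<Psi> 0) (at_right 0)"
    using assms by (auto simp: N_function_def continuous_on_def intro: tendsto_within_subset)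
  have "((\<lambda>s. \<Psi> s / s * s) \<longlongrightarrow> 0 * 0) (at_right 0)"
    using assms by (intro tendsto_intros) (auto simp: N_function_def)
  moreover have "\<forall>\<^sub>F s in at_right 0. \<Psi> s / s * s = \<Psi> s"
    using eventually_at_right_less[of "0::real"] by eventually_elim simp
  ultimately have "(\<Psi> \<longlongrightarrow> 0) (at_right 0)"
    by (simp add: Lim_transform_eventually)
  with cont show ?thesis
    using tendsto_unique[OF trivial_limit_at_right_real] by blast
qed

text \<open>Superlinear growth makes the expression non-positive beyond some threshold, and below it
  \<open>s * \<bar>t\<bar>\<close> is a bound. Without boundedness the real supremum in
  \<open>complementary\<close> would carry no information.\<close>

lemma complementary_bdd_above:
  assumes "N_function \<Psi>"
  shows "bdd_above ((\<lambda>s. s * \<bar>t\<bar> - \<Psi> s) ` {0..})"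
proof -
  have "\<forall>\<^sub>F s in at_top. \<bar>t\<bar> \<le> \<Psi> s / s"
    using assms by (auto simp: N_function_def filterlim_at_top)
  then obtain S where S: "\<And>s. s \<ge> S \<Longrightarrow> \<bar>t\<bar> \<le> \<Psi> s / s"
    by (auto simp: eventually_at_top_linorder)
  have nonneg: "0 \<le> \<Psi> s" for s using assms by (simp add: N_function_def)
  have "s * \<bar>t\<bar> - \<Psi> s \<le> max S 1 * \<bar>t\<bar>" if "s \<ge> 0" for s
  proof (cases "s \<ge> max S 1")
    case True
    then have "s * \<bar>t\<bar> \<le> \<Psi> s" using S[of s] by (simp add: field_simps)
    then show ?thesis by (smt (verit) abs_ge_zero mult_nonneg_nonneg)
  next
    case False
    then have "s * \<bar>t\<bar> \<le> max S 1 * \<bar>t\<bar>" by (intro mult_right_mono) auto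
    then show ?thesis using nonneg[of s] by linarith
  qed
  then show ?thesis by (intro bdd_aboveI2[of _ _ "max S 1 * \<bar>t\<bar>"]) auto
qed

lemma Young_inequality:
  assumes "N_function \<Psi>"
  shows "\<bar>a * b\<bar> \<le> \<Psi> a + complementary \<Psi> b"
proof -
  have "\<Psi> \<bar>a\<bar> = \<Psi> a" using assms by (auto simp: N_function_def abs_if)
  moreover have "\<bar>a\<bar> * \<bar>b\<bar> - \<Psi> \<bar>a\<bar> \<le> complementary \<Psi> b"
    unfolding complementary_def
    by (rule cSUP_upper[OF _ complementary_bdd_above[OF assms]]) simp
  ultimately show ?thesis by (simp add: abs_mult)
qed

text \<open>In the non-integrable case the left side is the default value 0.\<close>

lemma ennreal_abs_integral_le: "ennreal \<bar>LINT x|M. f x\<bar> \<le> (\<integral>\<^sup>+x. ennreal \<bar>f x\<bar> \<partial>M)"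
proof (cases "integrable M f")
  case True
  then show ?thesis using integral_norm_bound_ennreal[OF True] by simp
qed (simp add: not_integrable_integral_eq)

text \<open>Integrating Young's inequality bounds every admissible pairing by the integral of
  \<open>\<Psi> (f x)\<close> plus 1, uniformly in \<open>g\<close>.\<close>

lemma orlicz_norm_finite:
  fixes f :: "'a::euclidean_space \<Rightarrow> real"
  assumes \<Psi>: "N_function \<Psi>" and f: "f \<in> borel_measurable lebesgue"
    and fin: "(\<integral>\<^sup>+x. ennreal (\<Psi> (f x)) \<partial>lebesgue) < \<infinity>"
  shows "orlicz_norm \<Psi> f < \<infinity>"
proof -
  have "f \<in> orlicz_space \<Psi>"
    using f fin by (auto simp: orlicz_space_def intro!: exI[of _ 1])
  moreover have "ennreal \<bar>LINT x|lebesgue. f x * g x\<bar> \<le> (\<integral>\<^sup>+x. ennreal (\<Psi> (f x)) \<partial>lebesgue) + 1"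
    if g: "g \<in> borel_measurable lebesgue"
      and g1: "(\<integral>\<^sup>+x. ennreal (complementary \<Psi> (g x)) \<partial>lebesgue) \<le> 1" for g
  proof -
    have "\<Psi> \<in> borel_measurable borel"
      using \<Psi> by (intro borel_measurable_continuous_onI) (simp add: N_function_def)
    then have [measurable]: "(\<lambda>x. \<Psi> (f x)) \<in> borel_measurable lebesgue"
      using f by (rule measurable_compose_rev)
    note [measurable] = f g
    have nonneg: "0 \<le> \<Psi> s" for s using \<Psi> by (simp add: N_function_def)
    have "ennreal \<bar>LINT x|lebesgue. f x * g x\<bar> \<le> (\<integral>\<^sup>+x. ennreal \<bar>f x * g x\<bar> \<partial>lebesgue)"
      by (rule ennreal_abs_integral_le)
    \<comment> \<open>The excess of \<open>\<bar>f x * g x\<bar>\<close> over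
      \<open>\<Psi> (f x)\<close> stands in for the complementary function of \<open>g x\<close>. It
      is visibly measurable, so the integral can be split; the comparison with
      \<open>complementary\<close> afterwards uses monotonicity only, which asks for no
      measurability.\<close>
    also have "\<dots> \<le> (\<integral>\<^sup>+x. ennreal (\<Psi> (f x)) + ennreal (max 0 (\<bar>f x * g x\<bar> - \<Psi> (f x))) \<partial>lebesgue)"
      using nonneg by (intro nn_integral_mono) (simp flip: ennreal_plus)
    also have "\<dots> = (\<integral>\<^sup>+x. ennreal (\<Psi> (f x)) \<partial>lebesgue) +
        (\<integral>\<^sup>+x. ennreal (max 0 (\<bar>f x * g x\<bar> - \<Psi> (f x))) \<partial>lebesgue)"
      by (rule nn_integral_add) measurable
    also have "(\<integral>\<^sup>+x. ennreal (max 0 (\<bar>f x * g x\<bar> - \<Psi> (f x))) \<partial>lebesgue)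
        \<le> (\<integral>\<^sup>+x. ennreal (complementary \<Psi> (g x)) \<partial>lebesgue)"
    proof (rule nn_integral_mono)
      fix x
      have "\<bar>f x * g x\<bar> - \<Psi> (f x) \<le> complementary \<Psi> (g x)"
        using Young_inequality[OF \<Psi>, of "f x" "g x"] by linarith
      then show "ennreal (max 0 (\<bar>f x * g x\<bar> - \<Psi> (f x))) \<le> ennreal (complementary \<Psi> (g x))"
        by (auto simp: max_def intro: ennreal_leI)
    qed
    also note g1
    finally show ?thesis by (simp add: add_left_mono)
  qed
  ultimately have "orlicz_norm \<Psi> f \<le> (\<integral>\<^sup>+x. ennreal (\<Psi> (f x)) \<partial>lebesgue) + 1"
    unfolding orlicz_norm_def by (auto intro!: SUP_least)
  also have "\<dots> < \<infinity>" using fin by simp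
  finally show ?thesis .
qed

text \<open>The first equation determines \<open>t\<close> from \<open>n\<close>. Then
  \<open>t * r^2 = 16 / n\<close> tends to 0, while \<open>B_fun t\<close> behaves like
  \<open>t * ln t\<close> with \<open>ln t\<close> of order \<open>n * ln 4\<close>, so that
  \<open>B_fun t * r^2\<close> tends to \<open>16 * ln 4\<close>. Multiplying by the vanishing
  quotient \<open>\<Psi> t / B_fun t\<close> gives the last estimate for all large
  \<open>n\<close>.\<close>

lemma ex_well_parameters:
  assumes R: "R > 0" and \<delta>: "\<delta> > 0"
    and lim: "((\<lambda>s. \<Psi> s / B_fun s) \<longlongrightarrow> 0) at_top"
  shows "\<exists>n t. n > 0 \<and> t > 0 \<and> t * (R / 2 ^ n)\<^sup>2 * real n = 16 \<and>
    t * (R / 2 ^ n)\<^sup>2 \<le> \<delta> \<and> \<Psi> t * (R / 2 ^ n)\<^sup>2 \<le> \<delta>"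
proof -
  define t where "t n = 16 * 4 ^ n / (real n * R\<^sup>2)" for n :: nat
  have t_top: "filterlim t at_top sequentially"
    unfolding t_def using R by real_asymp
  have sq: "(R / 2 ^ n)\<^sup>2 = R\<^sup>2 / 4 ^ n" for n
    using power_mult_distrib[of "2::real" 2 n] by (simp add: power_divide power2_eq_square)
  have t_sq: "t n * (R / 2 ^ n)\<^sup>2 * real n = 16" if "n > 0" for n
    using that R by (simp add: t_def sq)
  have t_sq': "(\<lambda>n. t n * (R / 2 ^ n)\<^sup>2) \<longlonglongrightarrow> 0"
    unfolding t_def sq using R by real_asymp
  have B_lim: "(\<lambda>n. B_fun (t n) * (R / 2 ^ n)\<^sup>2) \<longlonglongrightarrow> 16 * ln 4"
  proof -
    have "(\<lambda>n. ((1 + t n) * ln (1 + t n) - t n) * (R / 2 ^ n)\<^sup>2) \<longlonglongrightarrow> 16 * ln 4"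
      unfolding t_def sq using R by real_asymp
    moreover have "t n \<ge> 0" for n by (simp add: t_def)
    ultimately show ?thesis by (simp add: B_fun_def)
  qed
  have "(\<lambda>n. \<Psi> (t n) / B_fun (t n) * (B_fun (t n) * (R / 2 ^ n)\<^sup>2)) \<longlonglongrightarrow> 0 * (16 * ln 4)"
    by (intro tendsto_mult B_lim filterlim_compose[OF lim t_top])
  moreover have "\<forall>\<^sub>F n in sequentially. \<Psi> (t n) / B_fun (t n) * (B_fun (t n) * (R / 2 ^ n)\<^sup>2) = \<Psi> (t n) * (R / 2 ^ n)\<^sup>2"
  proof -
    \<comment> \<open>The limit \<open>16 * ln 4\<close> is positive, so \<open>B_fun (t n)\<close>
      is eventually non-zero and cancels.\<close>
    have "\<forall>\<^sub>F n in sequentially. 0 < B_fun (t n) * (R / 2 ^ n)\<^sup>2"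
      using order_tendstoD(1)[OF B_lim, of 0] by simp
    then show ?thesis by eventually_elim auto
  qed
  ultimately have \<Psi>_lim: "(\<lambda>n. \<Psi> (t n) * (R / 2 ^ n)\<^sup>2) \<longlonglongrightarrow> 0"
    by (simp add: Lim_transform_eventually)
  have "\<forall>\<^sub>F n in sequentially. n > 0 \<and> t n * (R / 2 ^ n)\<^sup>2 < \<delta> \<and> \<Psi> (t n) * (R / 2 ^ n)\<^sup>2 < \<delta>"
    by (intro eventually_conj eventually_gt_at_top order_tendstoD(2)[OF t_sq' \<delta>] order_tendstoD(2)[OF \<Psi>_lim \<delta>])
  then obtain n where n: "n > 0" "t n * (R / 2 ^ n)\<^sup>2 < \<delta>" "\<Psi> (t n) * (R / 2 ^ n)\<^sup>2 < \<delta>"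
    using eventually_happens'[OF sequentially_bot] by blast
  moreover have "t n > 0" using n(1) R by (simp add: t_def)
  ultimately show ?thesis using t_sq[OF n(1)] by (intro exI[of _ n] exI[of _ "t n"]) auto
qed

section \<open>The potential\<close>

text \<open>Applied pointwise to functions with disjoint supports, this removes all cross terms from
  the quadratic form.\<close>

lemma norm_sum_squared_if_at_most_one_nonzero:
  fixes f :: "'k \<Rightarrow> 'b::real_normed_vector"
  assumes "finite S" "\<And>j k. j \<in> S \<Longrightarrow> k \<in> S \<Longrightarrow> j \<noteq> k \<Longrightarrow> f j = 0 \<or> f k = 0"
  shows "(norm (sum f S))\<^sup>2 = (\<Sum>k\<in>S. (norm (f k))\<^sup>2)"
proof (cases "\<exists>k\<in>S. f k \<noteq> 0")
  case True
  then obtain k where k: "k \<in> S" "f k \<noteq> 0" by blast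
  then have "f j = 0" if "j \<in> S - {k}" for j using assms(2)[of j k] that by blast
  then show ?thesis using assms(1) k by (simp add: sum.remove[of S k])
qed simp

text \<open>\<open>strength\<close> is what makes the form negative, \<open>size\<close> what makes
  the potential summable. The smallness relative to \<open>\<Psi>\<close> stays outside and enters
  only in \<open>orlicz_norm_V_finite\<close>.\<close>

locale dyadic_wells =
  fixes c :: "nat \<Rightarrow> real^2" and R :: "nat \<Rightarrow> real" and n :: "nat \<Rightarrow> nat" and t :: "nat \<Rightarrow> real"
  assumes R: "R k > 0" and n: "n k > 0" and t: "t k > 0"
    and disjoint: "j \<noteq> k \<Longrightarrow> ball (c j) (R j) \<inter> ball (c k) (R k) = {}"
    and strength: "t k * (R k / 2 ^ n k)\<^sup>2 * real (n k) = 16"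
    and size: "t k * (R k / 2 ^ n k)\<^sup>2 \<le> (1 / 2) ^ k"
begin

abbreviation "r k \<equiv> R k / 2 ^ n k"

text \<open>At each point at most one term of the series is non-zero, by disjointness of the wells,
  so the real series always converges.\<close>

definition V :: "real^2 \<Rightarrow> real"
  where "V x = (\<Sum>k. t k * indicator (ball (c k) (r k)) x)"

definition w :: "nat \<Rightarrow> real^2 \<Rightarrow> complex"
  where "w k x = complex_of_real (log_cutoff (c k) (r k) (R k) x)"

definition dw :: "nat \<Rightarrow> 2 \<Rightarrow> real^2 \<Rightarrow> complex"
  where "dw k i x = complex_of_real (log_cutoff_grad (c k) (r k) (R k) i x)"

lemma r: "0 < r k" "r k < R k"
proof -
  have "(2::real) ^ n k > 1" using n by simp
  then show "0 < r k" "r k < R k" using R[of k] by (simp_all add: field_simps)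
qed

lemma inner_ball_subset: "ball (c k) (r k) \<subseteq> ball (c k) (R k)"
  using r[of k] by (intro subset_ball) simp

lemma disjointD: "x \<in> ball (c j) (R j) \<Longrightarrow> x \<in> ball (c k) (R k) \<Longrightarrow> j = k"
  using disjoint by blast

lemma V_inner: "x \<in> ball (c k) (R k) \<Longrightarrow> V x = t k * indicator (ball (c k) (r k)) x"
proof -
  assume x: "x \<in> ball (c k) (R k)"
  have "x \<notin> ball (c j) (r j)" if "j \<noteq> k" for j
    using that x inner_ball_subset[of j] disjointD[of x j k] by blast
  then have "V x = (\<Sum>j\<in>{k}. t j * indicator (ball (c j) (r j)) x)"
    unfolding V_def by (intro suminf_finite) (auto simp: indicator_def)
  then show ?thesis by (simp only: sum.insert sum.empty finite.emptyI empty_iff not_False_eq_True add_0_right)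
qed

lemma V_outer: "(\<And>k. x \<notin> ball (c k) (r k)) \<Longrightarrow> V x = 0"
  by (simp add: V_def)

lemma V_nonneg: "0 \<le> V x"
proof (cases "\<exists>k. x \<in> ball (c k) (r k)")
  case True
  then obtain k where "x \<in> ball (c k) (r k)" by blast
  then show ?thesis using V_inner[of x k] inner_ball_subset[of k] t[of k] by (auto simp: subset_iff)
qed (simp add: V_outer)

lemma V_measurable [measurable]: "V \<in> borel_measurable borel"
  unfolding V_def[abs_def]
  by (intro borel_measurable_suminf borel_measurable_times borel_measurable_indicator) auto

lemma V_support: "{x. V x \<noteq> 0} \<subseteq> (\<Union>k. ball (c k) (R k))"
  using V_outer inner_ball_subset by blast

text \<open>One estimate for three integrals: \<open>F\<close> is the identity for integrability of
  \<open>V\<close>, \<open>\<Psi>\<close> for the Orlicz norm, and a multiple of the identity for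
  the integral against \<open>W\<close>. Pointwise \<open>F (V x)\<close> is a single term of the
  series over the wells, or \<open>F 0\<close>, and the areas \<open>pi * (r k)^2\<close> turn the
  series into a geometric one.\<close>

lemma nn_integral_V_finite:
  assumes "F 0 = 0" "\<And>k. F (t k) * (r k)\<^sup>2 \<le> C * (1 / 2) ^ k"
  shows "(\<integral>\<^sup>+x. ennreal (F (V x)) \<partial>lebesgue) < \<infinity>"
proof -
  have C: "0 \<le> max C 0" by simp
  have "(\<integral>\<^sup>+x. ennreal (F (V x)) \<partial>lebesgue) \<le>
      (\<integral>\<^sup>+x. (\<Sum>k. ennreal (F (t k)) * indicator (ball (c k) (r k)) x) \<partial>lebesgue)"
  proof (rule nn_integral_mono)
    fix x
    show "ennreal (F (V x)) \<le> (\<Sum>k. ennreal (F (t k)) * indicator (ball (c k) (r k)) x)"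
    proof (cases "\<exists>k. x \<in> ball (c k) (r k)")
      case True
      then obtain k where k: "x \<in> ball (c k) (r k)" by blast
      then have "V x = t k" using V_inner[of x k] inner_ball_subset[of k] by (auto simp: subset_iff)
      then have "ennreal (F (V x)) = (\<Sum>j\<in>{k}. ennreal (F (t j)) * indicator (ball (c j) (r j)) x)"
        using k by simp
      also have "\<dots> \<le> (\<Sum>k. ennreal (F (t k)) * indicator (ball (c k) (r k)) x)"
        by (rule sum_le_suminf) auto
      finally show ?thesis .
    qed (simp add: V_outer assms)
  qed
  also have "\<dots> = (\<Sum>k. (\<integral>\<^sup>+x. ennreal (F (t k)) * indicator (ball (c k) (r k)) x \<partial>lebesgue))"
    by (intro nn_integral_suminf borel_measurable_times_ennreal borel_measurable_indicator) auto
  also have "\<dots> \<le> (\<Sum>k. ennreal (pi * max C 0 * (1 / 2) ^ k))"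
  proof (intro suminf_le allI)
    fix k
    have "(\<integral>\<^sup>+x. ennreal (F (t k)) * indicator (ball (c k) (r k)) x \<partial>lebesgue) =
        ennreal (F (t k)) * emeasure lebesgue (ball (c k) (r k))"
      by (rule nn_integral_cmult_indicator) simp
    also have "emeasure lebesgue (ball (c k) (r k)) = ennreal (pi * (r k)\<^sup>2)"
      using emeasure_ball[of "r k" "c k"] r[of k] by (simp add: unit_ball_vol_2)
    also have "ennreal (F (t k)) * ennreal (pi * (r k)\<^sup>2) = ennreal (F (t k) * (pi * (r k)\<^sup>2))"
      by (rule ennreal_mult''[symmetric]) simp
    also have "\<dots> \<le> ennreal (pi * max C 0 * (1 / 2) ^ k)"
    proof (rule ennreal_leI)
      have "F (t k) * (r k)\<^sup>2 \<le> max C 0 * (1 / 2) ^ k"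
        by (rule order_trans[OF assms(2)]) (intro mult_right_mono, auto)
      from mult_left_mono[OF this, of pi] show "F (t k) * (pi * (r k)\<^sup>2) \<le> pi * max C 0 * (1 / 2) ^ k"
        by (simp add: mult_ac)
    qed
    finally show "(\<integral>\<^sup>+x. ennreal (F (t k)) * indicator (ball (c k) (r k)) x \<partial>lebesgue) \<le>
        ennreal (pi * max C 0 * (1 / 2) ^ k)" .
  qed auto
  also have "\<dots> < \<infinity>"
  proof -
    have "summable (\<lambda>k. pi * max C 0 * (1 / 2) ^ k)"
      by (intro summable_mult summable_geometric) simp
    moreover have "0 \<le> pi * max C 0 * (1 / 2) ^ k" for k
      by (intro mult_nonneg_nonneg zero_le_power C) auto
    ultimately have "(\<Sum>k. ennreal (pi * max C 0 * (1 / 2) ^ k)) \<noteq> top"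
      by (rule ennreal_suminf_neq_top)
    then show ?thesis unfolding less_top infinity_ennreal_def .
  qed
  finally show ?thesis .
qed

lemma V_integrable: "integrable lebesgue V"
proof (rule integrableI_nonneg)
  show "V \<in> borel_measurable lebesgue"
    by (rule measurable_completion) measurable
  show "(\<integral>\<^sup>+x. ennreal (V x) \<partial>lebesgue) < \<infinity>"
    by (rule nn_integral_V_finite[of "\<lambda>s. s" 1]) (use size in simp_all)
qed (simp add: V_nonneg)

section \<open>The cutoffs as trial functions\<close>

lemma w_inner: "x \<in> ball (c k) (r k) \<Longrightarrow> w k x = of_real (real (n k) * ln 2)"
proof -
  assume "x \<in> ball (c k) (r k)"
  then have "w k x = of_real (ln (R k / r k))"
    using r[of k] by (simp add: w_def log_cutoff_inner dist_norm norm_minus_commute)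
  also have "R k / r k = 2 ^ n k" using R[of k] by simp
  finally show ?thesis by (simp add: ln_realpow)
qed

lemma w_outer: "x \<notin> ball (c k) (R k) \<Longrightarrow> w k x = 0"
  using r[of k] by (simp add: w_def log_cutoff_outer dist_norm norm_minus_commute)

lemma dw_outer: "x \<notin> ball (c k) (R k) \<Longrightarrow> dw k i x = 0"
  by (auto simp: dw_def log_cutoff_grad_def dist_norm norm_minus_commute)

lemma norm_w_le: "cmod (w k x) \<le> real (n k) * ln 2"
proof -
  have "cmod (w k x) \<le> ln (R k / r k)"
    using log_cutoff_bounds[OF r(1)[of k] r(2)[of k], of "c k" x] by (simp add: w_def)
  also have "R k / r k = 2 ^ n k" using R[of k] by simp
  finally show ?thesis by (simp add: ln_realpow)
qed

lemma w_measurable [measurable]: "w k \<in> borel_measurable borel"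
proof -
  have "continuous_on UNIV (log_cutoff (c k) (r k) (R k))"
    using log_cutoff_lipschitz[OF r] by (rule lipschitz_on_continuous_on)
  then show ?thesis
    unfolding w_def[abs_def] by (intro borel_measurable_continuous_onI continuous_intros)
qed

lemma dw_measurable [measurable]: "dw k i \<in> borel_measurable borel"
  unfolding dw_def[abs_def] by measurable

lemma has_weak_pderiv_w: "has_weak_pderiv i (w k) (dw k i)"
  unfolding w_def[abs_def] dw_def[abs_def] by (rule has_weak_pderiv_log_cutoff[OF r])

text \<open>On the support of \<open>w k\<close> the potential consists of the \<open>k\<close>-th
  well alone, and on that well \<open>w k\<close> is constant; the potential energy reduces to the
  area of a disc.\<close>

lemma V_mult_w: "V x * (cmod (w k x))\<^sup>2 = t k * (real (n k) * ln 2)\<^sup>2 * indicator (ball (c k) (r k)) x"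
proof (cases "x \<in> ball (c k) (R k)")
  case True
  then show ?thesis using w_inner[of x k] by (auto simp: V_inner indicator_def norm_mult abs_mult)
next
  case False
  then show ?thesis using inner_ball_subset[of k] by (auto simp: w_outer indicator_def)
qed

lemma integrable_indicator_ball: "integrable lebesgue (indicat_real (ball a s :: (real^2) set))"
  using lmeasurable_ball[of a s] by (intro integrable_real_indicator) (auto simp: fmeasurable_def)

lemma energy: "integrable lebesgue (\<lambda>x. \<Sum>i\<in>UNIV. (cmod (dw k i x))\<^sup>2)"
    "(LINT x|lebesgue. (\<Sum>i\<in>UNIV. (cmod (dw k i x))\<^sup>2)) \<le> 4 * pi * n k"
  using log_cutoff_energy[OF R[of k] n[of k], of "c k"] by (simp_all add: dw_def)

lemma integrable_dw_squared: "integrable lebesgue (\<lambda>x. (cmod (dw k i x))\<^sup>2)"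
proof (rule Bochner_Integration.integrable_bound[OF energy(1)[of k]])
  show "(\<lambda>x. (cmod (dw k i x))\<^sup>2) \<in> borel_measurable lebesgue"
    by (rule measurable_completion) measurable
  have "(cmod (dw k i x))\<^sup>2 \<le> (\<Sum>i\<in>UNIV. (cmod (dw k i x))\<^sup>2)" for x
    by (rule member_le_sum) auto
  then show "AE x in lebesgue. norm ((cmod (dw k i x))\<^sup>2) \<le> norm (\<Sum>i\<in>UNIV. (cmod (dw k i x))\<^sup>2)"
    by (simp add: sum_nonneg)
qed

lemma integrable_w_squared: "integrable lebesgue (\<lambda>x. (cmod (w k x))\<^sup>2)"
proof (rule Bochner_Integration.integrable_bound)
  show "integrable lebesgue (\<lambda>x. (real (n k) * ln 2)\<^sup>2 * indicat_real (ball (c k) (R k)) x)"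
    by (intro integrable_mult_right integrable_indicator_ball)
  show "(\<lambda>x. (cmod (w k x))\<^sup>2) \<in> borel_measurable lebesgue"
    by (rule measurable_completion) measurable
  have "(cmod (w k x))\<^sup>2 \<le> (real (n k) * ln 2)\<^sup>2 * indicat_real (ball (c k) (R k)) x" for x
    using power_mono[OF norm_w_le norm_ge_zero, of k x 2] w_outer[of x k] by (auto simp: indicator_def)
  then show "AE x in lebesgue. norm ((cmod (w k x))\<^sup>2) \<le> norm ((real (n k) * ln 2)\<^sup>2 * indicat_real (ball (c k) (R k)) x)"
    by simp
qed

section \<open>Negativity of the form on linear combinations\<close>

lemma norm_sum_w: "finite S \<Longrightarrow> (cmod (\<Sum>k\<in>S. a k * w k x))\<^sup>2 = (\<Sum>k\<in>S. (cmod (a k))\<^sup>2 * (cmod (w k x))\<^sup>2)"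
  by (subst norm_sum_squared_if_at_most_one_nonzero)
    (auto simp: norm_mult power_mult_distrib intro: w_outer dest: disjointD)

lemma norm_sum_dw: "finite S \<Longrightarrow> (cmod (\<Sum>k\<in>S. a k * dw k i x))\<^sup>2 = (\<Sum>k\<in>S. (cmod (a k))\<^sup>2 * (cmod (dw k i x))\<^sup>2)"
  by (subst norm_sum_squared_if_at_most_one_nonzero)
    (auto simp: norm_mult power_mult_distrib intro: dw_outer dest: disjointD)

lemma V_mult_sum_w: "finite S \<Longrightarrow> V x * (cmod (\<Sum>k\<in>S. a k * w k x))\<^sup>2 =
    (\<Sum>k\<in>S. (cmod (a k))\<^sup>2 * (t k * (real (n k) * ln 2)\<^sup>2) * indicator (ball (c k) (r k)) x)"
proof -
  assume "finite S"
  then have "V x * (cmod (\<Sum>k\<in>S. a k * w k x))\<^sup>2 = (\<Sum>k\<in>S. (cmod (a k))\<^sup>2 * (V x * (cmod (w k x))\<^sup>2))"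
    by (simp add: norm_sum_w sum_distrib_left mult.left_commute)
  then show ?thesis by (simp add: V_mult_w mult.assoc)
qed

lemma sum_w_in_dom_E:
  assumes "finite S"
  shows "(\<lambda>x. \<Sum>k\<in>S. a k * w k x) \<in> dom_E V"
proof -
  let ?u = "\<lambda>x. \<Sum>k\<in>S. a k * w k x"
  have meas: "?u \<in> borel_measurable lebesgue"
    by (rule measurable_completion) measurable
  have "integrable lebesgue (\<lambda>x. (cmod (?u x))\<^sup>2)"
    unfolding norm_sum_w[OF assms]
    by (intro Bochner_Integration.integrable_sum integrable_mult_right integrable_w_squared)
  moreover have "integrable lebesgue (\<lambda>x. V x * (cmod (?u x))\<^sup>2)"
    unfolding V_mult_sum_w[OF assms]
    by (intro Bochner_Integration.integrable_sum integrable_mult_right integrable_indicator_ball)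
  moreover have "(\<lambda>x. \<Sum>k\<in>S. a k * dw k i x) \<in> L2" for i
  proof -
    have "(\<lambda>x. \<Sum>k\<in>S. a k * dw k i x) \<in> borel_measurable lebesgue"
      by (rule measurable_completion) measurable
    moreover have "integrable lebesgue (\<lambda>x. (cmod (\<Sum>k\<in>S. a k * dw k i x))\<^sup>2)"
      unfolding norm_sum_dw[OF assms]
      by (intro Bochner_Integration.integrable_sum integrable_mult_right integrable_dw_squared)
    ultimately show ?thesis by (simp add: L2_def)
  qed
  moreover have "has_weak_pderiv i ?u (\<lambda>x. \<Sum>k\<in>S. a k * dw k i x)" for i
    by (intro has_weak_pderiv_sum has_weak_pderiv_w)
  ultimately show ?thesis
    using meas unfolding dom_E_def W12_def L2_weighted_def L2_def[where 'a="real^2"] by blast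
qed

text \<open>Disjoint supports make both integrals diagonal in the coefficients, so kinetic and
  potential energy can be compared cutoff by cutoff. Each comparison is strict, but coefficients may
  vanish; \<open>k0\<close> keeps the sum strict.\<close>

lemma form_E_sum_w:
  assumes S: "finite S" and a: "k0 \<in> S" "a k0 \<noteq> 0"
  shows "form_E V (\<lambda>x. \<Sum>k\<in>S. a k * w k x) < 0"
proof -
  let ?u = "\<lambda>x. \<Sum>k\<in>S. a k * w k x"
  let ?e = "\<lambda>k x. \<Sum>i\<in>UNIV. (cmod (dw k i x))\<^sup>2"
  have int: "integrable lebesgue (\<lambda>x. \<Sum>k\<in>S. (cmod (a k))\<^sup>2 * ?e k x)"
    by (intro Bochner_Integration.integrable_sum integrable_mult_right energy)
  have "AE x in lebesgue. \<forall>i\<in>UNIV. weak_pderiv i ?u x = (\<Sum>k\<in>S. a k * dw k i x)"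
    by (intro AE_finite_allI finite weak_pderiv_AE_eq has_weak_pderiv_sum has_weak_pderiv_w)
  then have "AE x in lebesgue. (\<Sum>i\<in>UNIV. (cmod (weak_pderiv i ?u x))\<^sup>2) = (\<Sum>k\<in>S. (cmod (a k))\<^sup>2 * ?e k x)"
  proof eventually_elim
    case (elim x)
    then have "(\<Sum>i\<in>UNIV. (cmod (weak_pderiv i ?u x))\<^sup>2) = (\<Sum>i\<in>UNIV. \<Sum>k\<in>S. (cmod (a k))\<^sup>2 * (cmod (dw k i x))\<^sup>2)"
      by (simp add: norm_sum_dw[OF S])
    also have "\<dots> = (\<Sum>k\<in>S. (cmod (a k))\<^sup>2 * ?e k x)"
      by (subst sum.swap) (simp add: sum_distrib_left)
    finally show ?case .
  qed
  \<comment> \<open>Only integrability of the majorant is supplied: if the left side were not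
    integrable, its default value 0 would still lie below.\<close>
  then have "(LINT x|lebesgue. (\<Sum>i\<in>UNIV. (cmod (weak_pderiv i ?u x))\<^sup>2)) \<le> (LINT x|lebesgue. (\<Sum>k\<in>S. (cmod (a k))\<^sup>2 * ?e k x))"
    by (intro integral_mono_AE'[OF int]) (auto intro!: sum_nonneg mult_nonneg_nonneg elim!: eventually_mono)
  also have "\<dots> = (\<Sum>k\<in>S. (cmod (a k))\<^sup>2 * (LINT x|lebesgue. ?e k x))"
    using energy(1) by simp
  also have "\<dots> \<le> (\<Sum>k\<in>S. (cmod (a k))\<^sup>2 * (4 * pi * n k))"
    by (intro sum_mono mult_left_mono energy) auto
  also have "\<dots> < (\<Sum>k\<in>S. (cmod (a k))\<^sup>2 * (pi * 16 * n k * (ln 2)\<^sup>2))"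
  proof -
    have "(1 / 2)\<^sup>2 < (ln 2 :: real)\<^sup>2"
      using ln2_ge_two_thirds by (intro power_strict_mono) auto
    then have ln2: "4 < 16 * (ln 2 :: real)\<^sup>2" by (simp add: power2_eq_square)
    have lt: "4 * pi * n k < pi * 16 * n k * (ln 2)\<^sup>2" for k
    proof -
      have "4 * (pi * n k) < 16 * (ln 2)\<^sup>2 * (pi * n k)"
        using ln2 n[of k] by (intro mult_strict_right_mono) auto
      then show ?thesis by (simp add: mult_ac)
    qed
    show ?thesis
    proof (rule sum_strict_mono_ex1[OF S])
      show "\<forall>k\<in>S. (cmod (a k))\<^sup>2 * (4 * pi * n k) \<le> (cmod (a k))\<^sup>2 * (pi * 16 * n k * (ln 2)\<^sup>2)"
        by (intro ballI mult_left_mono less_imp_le[OF lt]) simp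
      show "\<exists>k\<in>S. (cmod (a k))\<^sup>2 * (4 * pi * n k) < (cmod (a k))\<^sup>2 * (pi * 16 * n k * (ln 2)\<^sup>2)"
        using a by (intro bexI[of _ k0] mult_strict_left_mono lt) auto
    qed
  qed
  also have "\<dots> = (\<Sum>k\<in>S. (cmod (a k))\<^sup>2 * (t k * (real (n k) * ln 2)\<^sup>2) * measure lebesgue (ball (c k) (r k)))"
  proof (rule sum.cong)
    fix k
    \<comment> \<open>One of the two factors \<open>n k\<close> joins \<open>t k * (r k)^2\<close>
      to form the left side of \<open>strength\<close>; the other one matches the linear growth of
      the energy bound.\<close>
    have "t k * (real (n k) * ln 2)\<^sup>2 * measure lebesgue (ball (c k) (r k)) =
        pi * (t k * (r k)\<^sup>2 * real (n k)) * n k * (ln 2)\<^sup>2"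
      using r[of k] by (subst measure_lebesgue_ball) (auto simp: power2_eq_square)
    then show "(cmod (a k))\<^sup>2 * (pi * 16 * n k * (ln 2)\<^sup>2) =
        (cmod (a k))\<^sup>2 * (t k * (real (n k) * ln 2)\<^sup>2) * measure lebesgue (ball (c k) (r k))"
      unfolding strength by (simp add: mult.assoc)
  qed simp
  also have "\<dots> = (LINT x|lebesgue. V x * (cmod (?u x))\<^sup>2)"
    unfolding V_mult_sum_w[OF S] using integrable_indicator_ball by simp
  finally show ?thesis by (simp add: form_E_def)
qed

end

section \<open>Dimension of the span of the cutoffs\<close>

lemma sum_fun_apply: "(\<Sum>k\<in>S. f k) x = (\<Sum>k\<in>S. f k x)"
  by (induction S rule: infinite_finite_induct) auto

context dyadic_wells
begin

text \<open>Up to non-zero factors, evaluation at the centres is a dual system to the cutoffs. It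
  yields injectivity of \<open>w\<close> and isolates single coefficients in the proof of
  independence.\<close>

lemma w_centre: "w j (c k) = (if j = k then of_real (real (n k) * ln 2) else 0)"
proof (cases "j = k")
  case True
  then show ?thesis using w_inner[of "c k" k] r(1)[of k] by simp
next
  case False
  have "c k \<in> ball (c k) (R k)" using R[of k] by simp
  then have "c k \<notin> ball (c j) (R j)" using disjointD[of "c k" j k] False by blast
  then show ?thesis using False by (simp add: w_outer)
qed

lemma w_centre_nonzero: "w k (c k) \<noteq> 0"
  using n[of k] by (simp add: w_centre)

lemma inj_w: "inj w"
  by (rule injI) (metis w_centre w_centre_nonzero)

text \<open>Coefficients in spans are indexed by the vectors themselves; this passes to indices
  \<open>k\<close>, which the estimates of the form use.\<close>

lemma sum_fscale_w:
  assumes "inj_on w S"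
  shows "(\<Sum>v\<in>w ` S. fscale (b v) v) = (\<lambda>x. \<Sum>k\<in>S. b (w k) * w k x)"
  using assms by (simp add: sum.reindex fun_eq_iff sum_fun_apply fscale_def)

lemma independent_w:
  assumes "finite S"
  shows "\<not> cfun.dependent (w ` S)"
proof (rule cfun.independent_if_scalars_zero)
  show "finite (w ` S)" using assms by simp
  fix b v assume 0: "(\<Sum>v\<in>w ` S. fscale (b v) v) = 0" and "v \<in> w ` S"
  then obtain k where k: "k \<in> S" "v = w k" by blast
  have "(\<lambda>x. \<Sum>j\<in>S. b (w j) * w j x) = 0"
    using 0 sum_fscale_w[OF inj_on_subset[OF inj_w]] by simp
  then have "0 = (\<Sum>j\<in>S. b (w j) * w j (c k))" by (metis zero_fun_apply)
  also have "\<dots> = (\<Sum>j\<in>S. if j = k then b (w k) * w k (c k) else 0)"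
    by (intro sum.cong) (auto simp: w_centre)
  also have "\<dots> = b (w k) * w k (c k)"
    using k assms by simp
  finally show "b v = 0" using k w_centre_nonzero by simp
qed

text \<open>The index is a supremum in \<open>enat\<close>, so it is enough to reach every natural
  number \<open>m\<close>, and the span of the first \<open>m\<close> cutoffs does so.\<close>

lemma neg_index_infinite: "neg_index (dom_E V) (form_E V) = \<infinity>"
proof -
  have ge: "enat m \<le> neg_index (dom_E V) (form_E V)" for m
  proof -
    let ?B = "w ` {..<m}"
    let ?L = "cfun.span ?B"
    have repr: "\<exists>a. u = (\<lambda>x. \<Sum>k<m. a k * w k x)" if u: "u \<in> ?L" for u
    proof -
      obtain b where "u = (\<Sum>v\<in>?B. fscale (b v) v)"
        using u by (auto simp: cfun.span_finite)
      then show ?thesis using sum_fscale_w[OF inj_on_subset[OF inj_w]] by auto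
    qed
    have "?L \<subseteq> dom_E V"
    proof
      fix u assume "u \<in> ?L"
      then obtain a where a: "u = (\<lambda>x. \<Sum>k<m. a k * w k x)" using repr by blast
      show "u \<in> dom_E V" unfolding a by (rule sum_w_in_dom_E) simp
    qed
    moreover have "form_E V u < 0" if u: "u \<in> ?L - {0}" for u
    proof -
      obtain a where a: "u = (\<lambda>x. \<Sum>k<m. a k * w k x)" using repr[of u] u by blast
      have "\<exists>k\<in>{..<m}. a k \<noteq> 0"
      proof (rule ccontr)
        assume "\<not> (\<exists>k\<in>{..<m}. a k \<noteq> 0)"
        then have "u = 0" by (simp add: a fun_eq_iff)
        then show False using u by simp
      qed
      then show ?thesis unfolding a by (auto intro: form_E_sum_w[OF finite_lessThan])
    qed
    moreover have "cfun.subspace ?L" by (rule cfun.subspace_span)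
    ultimately have "cfun_edim ?L \<le> neg_index (dom_E V) (form_E V)"
      unfolding neg_index_def by (intro SUP_upper) auto
    moreover have "cfun.dim ?L = m"
      using cfun.dim_span_eq_card_independent[OF independent_w[of "{..<m}"]]
        card_image[OF inj_on_subset[OF inj_w], of "{..<m}"] by simp
    then have "cfun_edim ?L = enat m"
      by (auto simp: cfun_edim_def)
    ultimately show ?thesis by simp
  qed
  show ?thesis
  proof (rule ccontr)
    assume "neg_index (dom_E V) (form_E V) \<noteq> \<infinity>"
    then obtain m where "neg_index (dom_E V) (form_E V) = enat m" by auto
    then show False using ge[of "Suc m"] by simp
  qed
qed

section \<open>Integrability and norms of the potential\<close>

lemma V_locally_integrable: "locally_integrable V"
  unfolding locally_integrable_def set_integrable_def
proof (intro allI impI)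
  fix K :: "(real^2) set" assume "compact K"
  then have "K \<in> sets lebesgue" using lmeasurable_compact by blast
  then show "integrable lebesgue (\<lambda>x. indicator K x *\<^sub>R V x)"
    by (rule integrable_mult_indicator[OF _ V_integrable])
qed

lemma orlicz_norm_V_finite:
  assumes "N_function \<Psi>" "\<And>k. \<Psi> (t k) * (r k)\<^sup>2 \<le> (1 / 2) ^ k"
  shows "orlicz_norm \<Psi> V < \<infinity>"
proof (rule orlicz_norm_finite[OF assms(1)])
  show "V \<in> borel_measurable lebesgue"
    by (rule measurable_completion) measurable
  show "(\<integral>\<^sup>+x. ennreal (\<Psi> (V x)) \<partial>lebesgue) < \<infinity>"
    using assms by (intro nn_integral_V_finite[of \<Psi> 1]) (simp_all add: N_function_0)
qed

lemma nn_integral_V_mult_finite: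
  assumes "\<And>k x. x \<in> ball (c k) (R k) \<Longrightarrow> W x \<le> M"
  shows "(\<integral>\<^sup>+x. ennreal (V x * W x) \<partial>lebesgue) < \<infinity>"
proof -
  have "V x * W x \<le> max M 0 * V x" for x
  proof (cases "V x = 0")
    case False
    then have "W x \<le> max M 0" using V_support assms by (force simp: max_def)
    then show ?thesis using mult_left_mono[OF _ V_nonneg[of x]] by (simp add: mult.commute)
  qed simp
  then have "(\<integral>\<^sup>+x. ennreal (V x * W x) \<partial>lebesgue) \<le> (\<integral>\<^sup>+x. ennreal (max M 0 * V x) \<partial>lebesgue)"
    by (intro nn_integral_mono ennreal_leI)
  also have "\<dots> < \<infinity>"
  proof (rule nn_integral_V_finite[of "\<lambda>s. max M 0 * s" "max M 0"])
    show "max M 0 * t k * (r k)\<^sup>2 \<le> max M 0 * (1 / 2) ^ k" for k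
      using mult_left_mono[OF size[of k], of "max M 0"] by (simp add: mult.assoc)
  qed simp
  finally show ?thesis .
qed

end

text \<open>The centres approach \<open>x0\<close> geometrically along a ray, and the radii are a
  small fraction of the distance to \<open>x0\<close>.\<close>

lemma ex_disjoint_balls:
  fixes x0 :: "'a::euclidean_space"
  assumes "\<rho> > 0"
  obtains c :: "nat \<Rightarrow> 'a" and R :: "nat \<Rightarrow> real" where
    "\<And>k. R k > 0" "\<And>k. ball (c k) (R k) \<subseteq> ball x0 \<rho>"
    "\<And>j k. j \<noteq> k \<Longrightarrow> ball (c j) (R j) \<inter> ball (c k) (R k) = {}"
proof -
  obtain e :: 'a where e: "norm e = 1" using vector_choose_size[of 1] by auto
  \<comment> \<open>For \<open>j < k\<close> the centres are at least \<open>a j / 2\<close> apart,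
    while the radii add up to at most \<open>a j / 8 + a j / 16\<close>. Containment holds since
    \<open>a k + a k / 8\<close> is below \<open>\<rho>\<close>, as \<open>a k\<close> is at most
    \<open>\<rho> / 2\<close>.\<close>
  define a where "a k = \<rho> / 2 ^ Suc k" for k
  define c where "c k = x0 + a k *\<^sub>R e" for k
  define R where "R k = a k / 8" for k
  have a: "a k > 0" "a k \<le> \<rho> / 2" for k
    using assms by (auto simp: a_def field_simps)
  have "ball (c k) (R k) \<subseteq> ball x0 \<rho>" for k
  proof (rule subsetI)
    fix x assume "x \<in> ball (c k) (R k)"
    moreover have "dist x0 (c k) = a k" using a[of k] e by (simp add: c_def dist_norm)
    ultimately show "x \<in> ball x0 \<rho>"
      using dist_triangle[of x0 x "c k"] a[of k] by (simp add: R_def)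
  qed
  moreover have disj: "ball (c j) (R j) \<inter> ball (c k) (R k) = {}" if "j < k" for j k
  proof -
    have "a k \<le> a j / 2"
    proof -
      have "(2::real) ^ Suc j \<le> 2 ^ k" using that by (intro power_increasing) auto
      then show ?thesis using assms by (simp add: a_def field_simps)
    qed
    moreover have "dist (c j) (c k) = \<bar>a j - a k\<bar>"
      using e by (simp add: c_def dist_norm flip: scaleR_diff_left)
    ultimately have "R j + R k \<le> dist (c j) (c k)"
      using a[of j] a[of k] by (simp add: R_def)
    then show ?thesis by (rule disjoint_ballI)
  qed
  then have "ball (c j) (R j) \<inter> ball (c k) (R k) = {}" if "j \<noteq> k" for j k
    using that disj by (metis Int_commute linorder_neqE_nat)
  moreover have "R k > 0" for k using a by (simp add: R_def)
  ultimately show ?thesis using that by blast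
qed

theorem theorem9p4:
  fixes W :: "real^2 \<Rightarrow> real" and \<Psi> :: "real \<Rightarrow> real"
  assumes "W \<in> borel_measurable lebesgue"
    and "\<forall>x. 0 \<le> W x"
    and "\<exists>x0 U. open U \<and> x0 \<in> U \<and> bounded (W ` U)"
    and "N_function \<Psi>"
    and "((\<lambda>s. \<Psi> s / B_fun s) \<longlongrightarrow> 0) at_top"
  shows "\<exists>V :: real^2 \<Rightarrow> real.
    locally_integrable V \<and> (\<forall>x. 0 \<le> V x) \<and> compact (closure {x. V x \<noteq> 0}) \<and>
    (\<integral>\<^sup>+x. ennreal (V x * W x) \<partial>lebesgue) + orlicz_norm \<Psi> V < \<infinity> \<and>
    neg_index (dom_E V) (form_E V) = \<infinity>"
proof -
  obtain x0 U where U: "open U" "x0 \<in> U" "bounded (W ` U)" using assms(3) by blast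
  obtain \<rho> where \<rho>: "\<rho> > 0" "ball x0 \<rho> \<subseteq> U" using U(1,2) open_contains_ball by blast
  obtain M where "\<And>y. y \<in> W ` U \<Longrightarrow> norm y \<le> M"
    using U(3) unfolding bounded_iff by blast
  then have M: "W x \<le> M" if "x \<in> U" for x
    using that by (fastforce simp: abs_le_iff)
  obtain c R where cR: "\<And>k::nat. R k > 0" "\<And>k. ball (c k) (R k) \<subseteq> ball x0 \<rho>"
    "\<And>j k. j \<noteq> k \<Longrightarrow> ball (c j) (R j) \<inter> ball (c k) (R k) = {}"
    using ex_disjoint_balls[OF \<rho>(1), of x0] by metis
  \<comment> \<open>The outer radii are already fixed by the geometry; for each of them depth and
    inner radius are adjusted separately, with tolerance \<open>(1 / 2) ^ k\<close> so that the
    contributions are summable.\<close>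
  have "\<forall>k. \<exists>n t. n > 0 \<and> t > 0 \<and> t * (R k / 2 ^ n)\<^sup>2 * real n = 16 \<and>
    t * (R k / 2 ^ n)\<^sup>2 \<le> (1 / 2) ^ k \<and> \<Psi> t * (R k / 2 ^ n)\<^sup>2 \<le> (1 / 2) ^ k"
    by (intro allI ex_well_parameters cR assms(5)) simp
  then obtain n t where nt: "\<And>k. n k > 0" "\<And>k. t k > 0" "\<And>k. t k * (R k / 2 ^ n k)\<^sup>2 * real (n k) = 16"
    "\<And>k. t k * (R k / 2 ^ n k)\<^sup>2 \<le> (1 / 2) ^ k" "\<And>k. \<Psi> (t k) * (R k / 2 ^ n k)\<^sup>2 \<le> (1 / 2) ^ k"
    by metis
  interpret dyadic_wells c R n t
    by unfold_locales (use cR nt in auto)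
  show ?thesis
  proof (intro exI conjI allI)
    show "locally_integrable V" by (rule V_locally_integrable)
    show "0 \<le> V x" for x by (rule V_nonneg)
    \<comment> \<open>All infinitely many wells lie in the one ball where \<open>W\<close> is
      bounded by \<open>M\<close>, which gives compact support here and the bound on the integral
      against \<open>W\<close> below.\<close>
    have "bounded {x. V x \<noteq> 0}"
      using V_support cR(2) by (blast intro: bounded_subset[OF bounded_ball[of x0 \<rho>]])
    then show "compact (closure {x. V x \<noteq> 0})" by simp
    have "(\<integral>\<^sup>+x. ennreal (V x * W x) \<partial>lebesgue) < \<infinity>"
      by (rule nn_integral_V_mult_finite[of _ M]) (use M \<rho>(2) cR(2) in blast)
    moreover have "orlicz_norm \<Psi> V < \<infinity>"
      by (rule orlicz_norm_V_finite[OF assms(4) nt(5)])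
    ultimately show "(\<integral>\<^sup>+x. ennreal (V x * W x) \<partial>lebesgue) + orlicz_norm \<Psi> V < \<infinity>"
      by simp
    show "neg_index (dom_E V) (form_E V) = \<infinity>" by (rule neg_index_infinite)
  qed
qed

end
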